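(* Let $(\mathcal{F},X)$ be a dynamical network with graph of interactions $\Gamma_{\mathcal{F}}$, and let $S$ be a basic structural set of $\Gamma_{\mathcal{F}}$. If $A$ is a stability matrix of $(\mathcal{F},X)$ with $\rho(A)<1$, then the restriction $(\mathcal{R}_S\mathcal{F},X|_S)$ has a globally attracting fixed point. Conversely, if $\tilde A$ is a stability matrix of $(\mathcal{R}_S\mathcal{F},X|_S)$ with $\rho(\tilde A)<1$, then $(\mathcal{F},X)$ has a globally attracting fixed point.
   Context: Dynamical networks. $\mathcal{I}=\{1,\dots,n\}$; for $i\in\mathcal{I}$, $(X_i,d)$ is a complete metric space and $\varphi_i:X_i\to X_i$ satisfies $L_i=\sup_{x\neq y}d(\varphi_i(x),\varphi_i(y))/d(x,y)<\infty$. $X=\prod_iX_i$ with $d_{max}(\mathbf{x},\mathbf{y})=\max_id(x_i,y_i)$, $\varphi=(\varphi_1,\dots,\varphi_n)$ acting coordinatewise. An interaction is a map $F:X\to X$ such that for each $j$ there are a nonempty $\mathcal{I}_j\subseteq\mathcal{I}$ and a continuous $F_j:\prod_{i\in\mathcal{I}_j}X_i\to X_j$ with $F(\mathbf{x})_j=F_j(\mathbf{x}|_{\mathcal{I}_j})$. The dynamical network is $(\mathcal{F},X)$ with $\mathcal{F}=F\circ\varphi$; its component $\mathcal{F}_j$ is a function of the variables $x_i$, $i\in\mathcal{I}_j$. A stability matrix of $(\mathcal{F},X)$ is a matrix $\Lambda^T\cdot\mathrm{diag}[L_1,\dots,L_n]$ where $\Lambda\in\mathbb{R}^{n\times n}$,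 $\Lambda_{ij}\ge0$, $\Lambda_{ij}=0$ if $i\notin\mathcal{I}_j$, and $d(F_j(\mathbf{x}|_{\mathcal{I}_j}),F_j(\mathbf{y}|_{\mathcal{I}_j}))\le\sum_{i\in\mathcal{I}_j}\Lambda_{ij}d(x_i,y_i)$ for all $j$ and all $\mathbf{x},\mathbf{y}\in X$. It is a standing assumption that $F$ satisfies such a Lipschitz condition for some finite constants. $\rho$ is the spectral radius. Graph. $\Gamma_{\mathcal{F}}$ is the directed graph with vertices $V=\{v_1,\dots,v_n\}$ and an edge $e_{ij}$ from $v_i$ to $v_j$ iff $i\in\mathcal{I}_j$. A path is a sequence of distinct vertices, consecutive ones joined by edges in the given direction; a cycle is the same with first and last vertex equal and otherwise distinct vertices (a loop at a vertex is a cycle). The interior vertices are those other than the first and last. $S\subseteq V$ is a complete structural set if every cycle of $\Gamma_{\mathcal{F}}$ contains a vertex of $S$ and every vertex of $V$ belongs to a path or cycle that begins and ends at vertices of $S$. Put $\mathcal{I}_S=\{i:v_i\in S\}$. For $i,j\in\mathcal{I}_S$, $\mathcal{B}_{ij}(\Gamma_{\mathcal{F}};S)$ is the set of paths (if $i\ne j$) and cycles (if $i=j$), having at least one edge, from $v_i$ to $v_j$ with no interior vertices in $S$. A complete structural set $S$ is a basic structural set if $|\mathcal{B}_{ij}(\Gamma_{\mathcal{F}};S)|\le1$ for all $i,j\in\mathcal{I}_S$. Restriction. For $j\in\mathcal{I}_S$ let $\mathcal{F}_{(j,0)}=\mathcal{F}_j$, and for $i\ge1$ let $\mathcal{F}_{(j,i)}$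 be obtained from $\mathcal{F}_{(j,i-1)}$ by replacing every variable $x_\ell$ with $\ell\notin\mathcal{I}_S$ by the function $\mathcal{F}_\ell$. Once all variables are indexed by $\mathcal{I}_S$ (which happens after finitely many steps), the resulting function is $\mathcal{R}_S\mathcal{F}_j$. The restriction is $(\mathcal{R}_S\mathcal{F},X|_S)$ with $X|_S=\prod_{i\in\mathcal{I}_S}X_i$ and $\mathcal{R}_S\mathcal{F}=(\mathcal{R}_S\mathcal{F}_j)_{j\in\mathcal{I}_S}$. It is considered as a network without local dynamics, so a stability matrix of it is a matrix $\tilde\Lambda^T$ with $\tilde\Lambda=(\tilde\Lambda_{ij})_{i,j\in\mathcal{I}_S}$, $\tilde\Lambda_{ij}\ge0$, $\tilde\Lambda_{ij}=0$ if $x_i$ is not a variable of $\mathcal{R}_S\mathcal{F}_j$, and $d(\mathcal{R}_S\mathcal{F}_j(\mathbf{x}),\mathcal{R}_S\mathcal{F}_j(\mathbf{y}))\le\sum_{i\in\mathcal{I}_S}\tilde\Lambda_{ij}d(x_i,y_i)$ for all $j\in\mathcal{I}_S$, $\mathbf{x},\mathbf{y}\in X|_S$. A network $(\mathcal{G},Y)$ has a globally attracting fixed point $\tilde{\mathbf{y}}$ if $\tilde{\mathbf y}$ is a fixed point and $\lim_{k\to\infty}d_{max}(\mathcal{G}^k(\mathbf{y}),\tilde{\mathbf{y}})=0$ for every $\mathbf{y}\in Y$. *)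

theory Defs
  imports
    "HOL-Analysis.Analysis"
    "Jordan_Normal_Form.Spectral_Radius"
    "Graph_Theory.Vertex_Walk"
begin

section \<open>Dynamical networks\<close>

text \<open>
  The spaces of the components may all be different: component \<open>i\<close> lives on its own carrier
  \<open>carr N i\<close> with its own metric \<open>metr N i\<close>; the common type \<open>'a\<close> merely holds all the carriers.
  Points of a product over an index set \<open>J\<close> are elements of \<open>PiE J (carr N)\<close>.  The family
  \<open>nbrs N\<close>, \<open>inter N\<close> is the family of sets \<open>I_j\<close> and maps \<open>F_j\<close> (with \<open>F_j\<close> defined on the
  product over \<open>I_j\<close>); the choice of the \<open>I_j\<close> is part of the network, since the graph of
  interactions depends on it.
\<close>

record 'a network =
  dim :: nat
  carr :: "nat \<Rightarrow> 'a set"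
  metr :: "nat \<Rightarrow> 'a \<Rightarrow> 'a \<Rightarrow> real"
  loc :: "nat \<Rightarrow> 'a \<Rightarrow> 'a"
  nbrs :: "nat \<Rightarrow> nat set"
  inter :: "nat \<Rightarrow> (nat \<Rightarrow> 'a) \<Rightarrow> 'a"

definition idx :: "'a network \<Rightarrow> nat set" where
  "idx N = {1..dim N}"

definition prod_space :: "'a network \<Rightarrow> nat set \<Rightarrow> (nat \<Rightarrow> 'a) set" where
  "prod_space N J = PiE J (carr N)"

definition dmax :: "'a network \<Rightarrow> nat set \<Rightarrow> (nat \<Rightarrow> 'a) \<Rightarrow> (nat \<Rightarrow> 'a) \<Rightarrow> real" where
  "dmax N J x y = Max ((\<lambda>i. metr N i (x i) (y i)) ` J)"

definition lip_ratios :: "'a network \<Rightarrow> nat \<Rightarrow> real set" where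
  "lip_ratios N i =
     {metr N i (loc N i x) (loc N i y) / metr N i x y | x y.
        x \<in> carr N i \<and> y \<in> carr N i \<and> x \<noteq> y}"

text \<open>
  The inserted \<open>0\<close> does not change the supremum of a nonempty set of ratios; it makes the
  supremum over a one-point space equal to \<open>0\<close>.
\<close>

definition lip_const :: "'a network \<Rightarrow> nat \<Rightarrow> real" where
  "lip_const N i = Sup (insert 0 (lip_ratios N i))"

definition lip_bounds :: "'a network \<Rightarrow> (nat \<Rightarrow> nat \<Rightarrow> real) \<Rightarrow> bool" where
  "lip_bounds N \<Lambda> \<longleftrightarrow>
     (\<forall>i\<in>idx N. \<forall>j\<in>idx N. 0 \<le> \<Lambda> i j \<and> (i \<notin> nbrs N j \<longrightarrow> \<Lambda> i j = 0)) \<and>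
     (\<forall>j\<in>idx N. \<forall>x\<in>prod_space N (idx N). \<forall>y\<in>prod_space N (idx N).
        metr N j (inter N j (restrict x (nbrs N j))) (inter N j (restrict y (nbrs N j)))
          \<le> (\<Sum>i\<in>nbrs N j. \<Lambda> i j * metr N i (x i) (y i)))"

definition dynamical_network :: "'a network \<Rightarrow> bool" where
  "dynamical_network N \<longleftrightarrow>
     1 \<le> dim N \<and>
     (\<forall>i\<in>idx N. carr N i \<noteq> {} \<and> Metric_space (carr N i) (metr N i) \<and>
        Metric_space.mcomplete (carr N i) (metr N i)) \<and>
     (\<forall>i\<in>idx N. loc N i \<in> carr N i \<rightarrow> carr N i \<and> bdd_above (lip_ratios N i)) \<and>
     (\<forall>j\<in>idx N. nbrs N j \<noteq> {} \<and> nbrs N j \<subseteq> idx N \<and>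
        continuous_map
          (product_topology (\<lambda>i. Metric_space.mtopology (carr N i) (metr N i)) (nbrs N j))
          (Metric_space.mtopology (carr N j) (metr N j))
          (inter N j)) \<and>
     (\<exists>\<Lambda>. lip_bounds N \<Lambda>)"

definition local_map :: "'a network \<Rightarrow> (nat \<Rightarrow> 'a) \<Rightarrow> nat \<Rightarrow> 'a" where
  "local_map N x = (\<lambda>i\<in>idx N. loc N i (x i))"

definition interaction :: "'a network \<Rightarrow> (nat \<Rightarrow> 'a) \<Rightarrow> nat \<Rightarrow> 'a" where
  "interaction N x = (\<lambda>j\<in>idx N. inter N j (restrict x (nbrs N j)))"

definition network_map :: "'a network \<Rightarrow> (nat \<Rightarrow> 'a) \<Rightarrow> nat \<Rightarrow> 'a" where
  "network_map N = interaction N \<circ> local_map N"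

text \<open>The component \<open>j\<close> of \<^const>\<open>network_map\<close>, as a function of the variables in \<open>nbrs N j\<close> only.\<close>

definition component :: "'a network \<Rightarrow> nat \<Rightarrow> (nat \<Rightarrow> 'a) \<Rightarrow> 'a" where
  "component N j x = inter N j (\<lambda>i\<in>nbrs N j. loc N i (x i))"

lemma network_map_component:
  assumes "dynamical_network N" "j \<in> idx N"
  shows "network_map N x j = component N j (restrict x (nbrs N j))"
proof -
  have "restrict (\<lambda>i\<in>idx N. loc N i (x i)) (nbrs N j)
      = (\<lambda>i\<in>nbrs N j. loc N i (restrict x (nbrs N j) i))"
    using assms by (auto simp: dynamical_network_def restrict_def fun_eq_iff)
  then show ?thesis
    using assms(2) by (simp add: network_map_def interaction_def local_map_def component_def)
qed


section \<open>Stability matrices\<close>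

text \<open>
  Matrices are indexed from \<open>0\<close>; a matrix with rows and columns indexed by a finite set \<open>J\<close> is
  transported along the increasing enumeration of \<open>J\<close>.
\<close>

definition enum_idx :: "nat set \<Rightarrow> nat \<Rightarrow> nat" where
  "enum_idx J a = sorted_list_of_set J ! a"

definition indexed_mat :: "nat set \<Rightarrow> (nat \<Rightarrow> nat \<Rightarrow> real) \<Rightarrow> real Matrix.mat" where
  "indexed_mat J \<Lambda> = Matrix.mat (card J) (card J) (\<lambda>(a, b). \<Lambda> (enum_idx J a) (enum_idx J b))"

definition stability_matrix :: "'a network \<Rightarrow> real Matrix.mat \<Rightarrow> bool" where
  "stability_matrix N A \<longleftrightarrow>
     (\<exists>\<Lambda>. lip_bounds N \<Lambda> \<and>
        A = transpose_mat (indexed_mat (idx N) \<Lambda>) *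
            mat_diag (dim N) (\<lambda>a. lip_const N (enum_idx (idx N) a)))"

definition spec_rad :: "real Matrix.mat \<Rightarrow> real" where
  "spec_rad A = spectral_radius (map_mat complex_of_real A)"


section \<open>The graph of interactions and its structural sets\<close>

definition interaction_graph :: "'a network \<Rightarrow> (nat, nat \<times> nat) pre_digraph" where
  "interaction_graph N =
     \<lparr>verts = idx N, arcs = {(i, j). i \<in> idx N \<and> j \<in> idx N \<and> i \<in> nbrs N j}, tail = fst, head = snd\<rparr>"

text \<open>
  Paths are \<^const>\<open>vpath\<close>; a single vertex is a path without edges.  A cycle is written as a vertex
  list whose first vertex is repeated at the end; a loop at \<open>v\<close> is the cycle \<open>[v, v]\<close>.
\<close>

definition vcycle :: "'v list \<Rightarrow> ('v, 'e) pre_digraph \<Rightarrow> bool" where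
  "vcycle p G \<longleftrightarrow> vwalk p G \<and> 1 \<le> vwalk_length p \<and> hd p = last p \<and> distinct (tl p)"

definition interior_verts :: "'v list \<Rightarrow> 'v set" where
  "interior_verts p = set (butlast (tl p))"

definition complete_structural_set :: "('v, 'e) pre_digraph \<Rightarrow> 'v set \<Rightarrow> bool" where
  "complete_structural_set G S \<longleftrightarrow>
     S \<subseteq> verts G \<and>
     (\<forall>p. vcycle p G \<longrightarrow> set p \<inter> S \<noteq> {}) \<and>
     (\<forall>v\<in>verts G. \<exists>p. (vpath p G \<or> vcycle p G) \<and> hd p \<in> S \<and> last p \<in> S \<and> v \<in> set p)"

definition branches :: "('v, 'e) pre_digraph \<Rightarrow> 'v set \<Rightarrow> 'v \<Rightarrow> 'v \<Rightarrow> 'v list set" where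
  "branches G S i j =
     {p. (if i = j then vcycle p G else vpath p G) \<and> 1 \<le> vwalk_length p \<and>
         hd p = i \<and> last p = j \<and> interior_verts p \<inter> S = {}}"

text \<open>In a finite graph there are only finitely many branches, so that \<^const>\<open>card\<close> counts them.\<close>

lemma finite_branches:
  assumes "finite (verts G)"
  shows "finite (branches G S i j)"
proof (rule finite_subset)
  show "branches G S i j \<subseteq> {p. set p \<subseteq> verts G \<and> length p \<le> Suc (card (verts G))}"
  proof
    fix p assume "p \<in> branches G S i j"
    then have p: "set p \<subseteq> verts G" "distinct (tl p)"
      by (auto simp: branches_def vcycle_def vpath_def vwalk_def distinct_tl split: if_splits)
    then have "set (tl p) \<subseteq> verts G"
      by (cases p) auto
    then have "length (tl p) \<le> card (verts G)"
      using p(2) assms by (metis card_mono distinct_card)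
    then show "p \<in> {p. set p \<subseteq> verts G \<and> length p \<le> Suc (card (verts G))}"
      using p(1) by auto
  qed
  show "finite {p. set p \<subseteq> verts G \<and> length p \<le> Suc (card (verts G))}"
    using assms by (rule finite_lists_length_le)
qed

definition basic_structural_set :: "('v, 'e) pre_digraph \<Rightarrow> 'v set \<Rightarrow> bool" where
  "basic_structural_set G S \<longleftrightarrow>
     complete_structural_set G S \<and> (\<forall>i\<in>S. \<forall>j\<in>S. card (branches G S i j) \<le> 1)"


section \<open>Restriction to a structural set\<close>

text \<open>
  The vertex \<open>v_i\<close> is identified with its index \<open>i\<close>, so \<open>S\<close> is also its own index set.
  \<open>subst_vars N S j k\<close> is the set of variables of the function obtained from component \<open>j\<close> after
  \<open>k\<close> substitution steps, and \<open>subst_fun N S j k\<close> is that function.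
\<close>

primrec subst_vars :: "'a network \<Rightarrow> nat set \<Rightarrow> nat \<Rightarrow> nat \<Rightarrow> nat set" where
  "subst_vars N S j 0 = nbrs N j"
| "subst_vars N S j (Suc k) =
     (subst_vars N S j k \<inter> S) \<union> (\<Union>l\<in>subst_vars N S j k - S. nbrs N l)"

primrec subst_fun :: "'a network \<Rightarrow> nat set \<Rightarrow> nat \<Rightarrow> nat \<Rightarrow> (nat \<Rightarrow> 'a) \<Rightarrow> 'a" where
  "subst_fun N S j 0 x = component N j x"
| "subst_fun N S j (Suc k) x =
     subst_fun N S j k (\<lambda>l\<in>subst_vars N S j k. if l \<in> S then x l else component N l x)"

definition subst_depth :: "'a network \<Rightarrow> nat set \<Rightarrow> nat \<Rightarrow> nat" where
  "subst_depth N S j = (LEAST k. subst_vars N S j k \<subseteq> S)"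

definition restr_vars :: "'a network \<Rightarrow> nat set \<Rightarrow> nat \<Rightarrow> nat set" where
  "restr_vars N S j = subst_vars N S j (subst_depth N S j)"

definition restr_component :: "'a network \<Rightarrow> nat set \<Rightarrow> nat \<Rightarrow> (nat \<Rightarrow> 'a) \<Rightarrow> 'a" where
  "restr_component N S j = subst_fun N S j (subst_depth N S j)"

definition restriction_map :: "'a network \<Rightarrow> nat set \<Rightarrow> (nat \<Rightarrow> 'a) \<Rightarrow> nat \<Rightarrow> 'a" where
  "restriction_map N S x = (\<lambda>j\<in>S. restr_component N S j x)"

definition restr_stability_matrix :: "'a network \<Rightarrow> nat set \<Rightarrow> real Matrix.mat \<Rightarrow> bool" where
  "restr_stability_matrix N S A \<longleftrightarrow>
     (\<exists>\<Lambda>. (\<forall>i\<in>S. \<forall>j\<in>S. 0 \<le> \<Lambda> i j \<and> (i \<notin> restr_vars N S j \<longrightarrow> \<Lambda> i j = 0)) \<and>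
        (\<forall>j\<in>S. \<forall>x\<in>prod_space N S. \<forall>y\<in>prod_space N S.
           metr N j (restr_component N S j x) (restr_component N S j y)
             \<le> (\<Sum>i\<in>S. \<Lambda> i j * metr N i (x i) (y i))) \<and>
        A = transpose_mat (indexed_mat S \<Lambda>))"


section \<open>Global attraction\<close>

definition globally_attracting_fixed_point ::
  "'a network \<Rightarrow> nat set \<Rightarrow> ((nat \<Rightarrow> 'a) \<Rightarrow> nat \<Rightarrow> 'a) \<Rightarrow> (nat \<Rightarrow> 'a) \<Rightarrow> bool" where
  "globally_attracting_fixed_point N J G z \<longleftrightarrow>
     z \<in> prod_space N J \<and> G z = z \<and>
     (\<forall>y\<in>prod_space N J. (\<lambda>k. dmax N J ((G ^^ k) y) z) \<longlonglongrightarrow> 0)"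

end

theory Submission
  imports Defs
begin

text \<open>
  A nonnegative matrix \<open>A\<close> of spectral radius below \<open>1\<close> admits positive weights \<open>w\<close> and a factor
  \<open>c < 1\<close> with \<open>A w \<le> c w\<close> (\<open>indexed_mat_weights\<close>).  A map whose componentwise Lipschitz constants
  are the entries of \<open>A\<close> is therefore a \<open>c\<close>-contraction for the maximum of the distances
  \<open>d(x_i, y_i) / w_i\<close>, and Banach's theorem gives a globally attracting fixed point
  (\<open>weighted_contraction_attracts\<close>).

  From the network to the restriction: substituting a component into another one never increases
  the weighted Lipschitz bound (\<open>subst_fun_contraction\<close>), so the weights of the stability matrix of
  the network, restricted to \<open>S\<close>, make the restriction a contraction.

  From the restriction to the network: the restriction is a contraction for suitable weights and
  has a fixed point, which extends to a fixed point \<open>z\<close> of the network (\<open>fixed_point_lift\<close>).  The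
  network itself need not be a contraction.  Its orbits do follow the restriction, but with time
  delays: the variable \<open>x_i\<close> enters \<open>x_j\<close> along a branch from \<open>i\<close> to \<open>j\<close> and arrives as many steps
  later as the branch has edges.  As \<open>S\<close> is basic there is at most one branch for each pair, so
  \<open>x_j(T) = R_j(\<dots>, x_i(T - \<tau>_ij), \<dots>)\<close> with constant delays (\<open>orbit_is_delayed_restriction\<close>);
  with two branches of different lengths, two different values of \<open>x_i\<close> would enter \<open>x_j(T)\<close>, and the
  Lipschitz bounds of \<open>R_j\<close>, where both are the same variable, would not control the two separately.
  A contraction
  with bounded delays still forces the distances to \<open>z\<close> to \<open>0\<close> on \<open>S\<close>
  (\<open>delayed_contraction_tendsto_0\<close>).  Outside \<open>S\<close> the graph is acyclic, so convergence propagates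
  from \<open>S\<close> to the remaining components through their finite Lipschitz constants.
\<close>

section \<open>Weights for nonnegative matrices of small spectral radius\<close>

text \<open>
  Links iteration of a real linear map with powers of the complex matrix it comes from, since the
  growth bounds from the Jordan normal form concern complex matrix powers.
\<close>

lemma funpow_matrix_action:
  fixes B :: "complex Matrix.mat" and M :: "nat \<Rightarrow> nat \<Rightarrow> real"
  assumes B: "B \<in> carrier_mat n n"
    and M: "\<And>a b. a < n \<Longrightarrow> b < n \<Longrightarrow> B $$ (a, b) = complex_of_real (M a b)"
    and a: "a < n"
  shows "complex_of_real (((\<lambda>v a. \<Sum>b<n. M a b * v b) ^^ k) v a)
       = (\<Sum>b<n. (B ^\<^sub>m k) $$ (a, b) * complex_of_real (v b))"
proof (induction k arbitrary: v)
  case 0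
  have "(\<Sum>b<n. (1\<^sub>m n) $$ (a, b) * complex_of_real (v b)) = (\<Sum>b<n. if b = a then complex_of_real (v b) else 0)"
    using a by (intro sum.cong) auto
  then show ?case using a B by simp
next
  case (Suc k)
  have Bk: "B ^\<^sub>m k \<in> carrier_mat n n" using B by simp
  have entry: "(B ^\<^sub>m Suc k) $$ (a, c) = (\<Sum>b<n. (B ^\<^sub>m k) $$ (a, b) * B $$ (b, c))" if "c < n" for c
    using a that B Bk by (simp add: scalar_prod_def atLeast0LessThan)
  have "complex_of_real (((\<lambda>v a. \<Sum>b<n. M a b * v b) ^^ Suc k) v a)
      = (\<Sum>b<n. (B ^\<^sub>m k) $$ (a, b) * complex_of_real (\<Sum>c<n. M b c * v c))"
    by (simp only: funpow_Suc_right comp_apply Suc.IH)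
  also have "\<dots> = (\<Sum>b<n. \<Sum>c<n. (B ^\<^sub>m k) $$ (a, b) * B $$ (b, c) * complex_of_real (v c))"
    by (intro sum.cong) (auto simp: sum_distrib_left M mult.assoc)
  also have "\<dots> = (\<Sum>c<n. \<Sum>b<n. (B ^\<^sub>m k) $$ (a, b) * B $$ (b, c) * complex_of_real (v c))"
    by (rule sum.swap)
  also have "\<dots> = (\<Sum>c<n. (B ^\<^sub>m Suc k) $$ (a, c) * complex_of_real (v c))"
    by (intro sum.cong refl) (simp only: entry lessThan_iff sum_distrib_right)
  finally show ?case .
qed

text \<open>
  Applied with some \<open>r\<close> strictly between the spectral radius and \<open>1\<close>, this turns the boundedness of
  matrix powers, which the Jordan normal form provides, into geometric decay of the powers of \<open>A\<close>.
\<close>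

lemma spectral_radius_smult_less_1:
  fixes A :: "complex Matrix.mat"
  assumes A: "A \<in> carrier_mat n n" and n: "n > 0" and r: "r > 0" "spectral_radius A < r"
  shows "spectral_radius (complex_of_real (1 / r) \<cdot>\<^sub>m A) < 1"
proof -
  let ?B = "complex_of_real (1 / r) \<cdot>\<^sub>m A"
  have B: "?B \<in> carrier_mat n n" using A by simp
  obtain k where k: "spectral_radius ?B = norm k" "eigenvalue ?B k"
    using spectral_radius_mem_max(1)[OF B n] by (auto simp: spectrum_def)
  then obtain v where v: "v \<in> carrier_vec n" "v \<noteq> 0\<^sub>v n" "?B *\<^sub>v v = k \<cdot>\<^sub>v v"
    using B by (auto simp: eigenvalue_def eigenvector_def)
  have "A *\<^sub>v v = (complex_of_real r * k) \<cdot>\<^sub>v v"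
  proof (rule eq_vecI)
    fix i assume i: "i < dim_vec ((complex_of_real r * k) \<cdot>\<^sub>v v)"
    have "vec_index (?B *\<^sub>v v) i = k * vec_index v i" using v i by simp
    moreover have "vec_index (?B *\<^sub>v v) i = vec_index (A *\<^sub>v v) i / complex_of_real r"
      using i v(1) A by (simp add: scalar_prod_def sum_divide_distrib)
    ultimately have "vec_index (A *\<^sub>v v) i / complex_of_real r = k * vec_index v i"
      by simp
    then show "vec_index (A *\<^sub>v v) i = vec_index ((complex_of_real r * k) \<cdot>\<^sub>v v) i"
      using r i by (simp add: field_simps)
  qed (use A v in auto)
  then have "eigenvalue A (complex_of_real r * k)"
    using v A unfolding eigenvalue_def eigenvector_def by auto
  then have "norm (complex_of_real r * k) \<le> spectral_radius A"
    using spectral_radius_mem_max(2)[OF A n] by (auto simp: spectrum_def)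
  then have "r * norm k \<le> spectral_radius A" using r by (simp add: norm_mult)
  then have "r * norm k < r * 1" using r by linarith
  then show ?thesis unfolding k(1) using r(1) by (simp only: mult_less_cancel_left_pos)
qed

text \<open>
  The Perron-Frobenius fact behind every contraction below.  Write \<open>A = r B\<close> with \<open>r < 1\<close> and
  the powers of \<open>B\<close> bounded.  The truncated Neumann series \<open>w = (\<Sum>k\<le>m. A^k 1)\<close> satisfies
  \<open>A w = w - 1 + A^(m+1) 1\<close>, and the last term is entrywise below \<open>1\<close> once \<open>m\<close> is large.  Truncation
  avoids any question of convergence.
\<close>

lemma spec_rad_less_1_weights:
  fixes A :: "real Matrix.mat"
  assumes A: "A \<in> carrier_mat n n" and sr: "spec_rad A < 1"
    and nonneg: "\<And>a b. a < n \<Longrightarrow> b < n \<Longrightarrow> 0 \<le> A $$ (a, b)"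
  obtains w where "\<And>a. a < n \<Longrightarrow> 0 < w a" "\<And>a. a < n \<Longrightarrow> (\<Sum>b<n. A $$ (a, b) * w b) < w a"
proof (cases "n = 0")
  case True
  then show ?thesis using that by auto
next
  case False
  let ?A = "map_mat complex_of_real A"
  define r where "r = (spec_rad A + 1) / 2"
  have A': "?A \<in> carrier_mat n n" using A by simp
  have "0 \<le> spec_rad A"
    using spectral_radius_mem_max(1)[OF A'] False by (auto simp: spec_rad_def)
  then have r: "0 < r" "r < 1" "spec_rad A < r"
    using sr by (auto simp: r_def)
  define B where "B = complex_of_real (1 / r) \<cdot>\<^sub>m ?A"
  have B: "B \<in> carrier_mat n n" using A by (simp add: B_def)
  have "spectral_radius B < 1"
    unfolding B_def by (rule spectral_radius_smult_less_1[OF A']) (use False r in \<open>auto simp: spec_rad_def\<close>)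
  then obtain c where c: "norm_bound (B ^\<^sub>m k) c" for k
    using spectral_radius_jnf_norm_bound_less_1_upper_triangular[OF B] by auto
  \<comment> \<open>\<open>M\<close> is the real form of \<open>B\<close>, and \<open>u k\<close> is \<open>B^k\<close> applied to the all-ones vector.\<close>
  define M where "M a b = A $$ (a, b) / r" for a b
  define u where "u k = ((\<lambda>v a. \<Sum>b<n. M a b * v b) ^^ k) (\<lambda>_. 1)" for k
  have u_Suc: "(\<Sum>b<n. M a b * u k b) = u (Suc k) a" for a k
    by (simp add: u_def)
  have u_nonneg: "0 \<le> u k a" if "a < n" for k a
    using that
  proof (induction k arbitrary: a)
    case (Suc k)
    then show ?case
      unfolding u_Suc[symmetric] using nonneg r by (auto simp: M_def intro!: sum_nonneg)
  qed (simp add: u_def)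
  have u_bound: "u k a \<le> real n * c" if a: "a < n" for k a
  proof -
    have "complex_of_real (u k a) = (\<Sum>b<n. (B ^\<^sub>m k) $$ (a, b) * complex_of_real 1)"
      unfolding u_def by (rule funpow_matrix_action[OF B _ a]) (use A in \<open>auto simp: B_def M_def\<close>)
    moreover have "norm (\<Sum>b<n. (B ^\<^sub>m k) $$ (a, b) * complex_of_real 1) \<le> (\<Sum>b<n. c)"
      by (rule sum_norm_le) (use c[of k] a B in \<open>auto simp: norm_bound_def\<close>)
    ultimately have "norm (complex_of_real (u k a)) \<le> real n * c" by simp
    then show ?thesis by simp
  qed
  have "(\<lambda>m. r ^ m * (real n * c)) \<longlonglongrightarrow> 0 * (real n * c)"
    using r by (intro tendsto_mult tendsto_const LIMSEQ_realpow_zero) auto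
  then have "eventually (\<lambda>m. r ^ m * (real n * c) < 1) sequentially"
    by (auto intro: order_tendstoD)
  then obtain m where m: "r ^ m * (real n * c) < 1"
    by (auto simp: eventually_sequentially)
  define w where "w a = (\<Sum>k<Suc m. r ^ k * u k a)" for a
  show ?thesis
  proof (rule that[of w])
    fix a assume a: "a < n"
    have "w a = 1 + (\<Sum>k<m. r ^ Suc k * u (Suc k) a)"
      unfolding w_def by (subst sum.lessThan_Suc_shift) (simp add: u_def)
    moreover have "0 \<le> (\<Sum>k<m. r ^ Suc k * u (Suc k) a)"
      using r u_nonneg[OF a] by (intro sum_nonneg) auto
    ultimately show "0 < w a" by simp
    have "(\<Sum>b<n. A $$ (a, b) * w b) = (\<Sum>b<n. \<Sum>k<Suc m. r ^ Suc k * (M a b * u k b))"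
      unfolding w_def sum_distrib_left using r by (intro sum.cong) (auto simp: M_def)
    also have "\<dots> = (\<Sum>k<Suc m. \<Sum>b<n. r ^ Suc k * (M a b * u k b))"
      by (rule sum.swap)
    also have "\<dots> = (\<Sum>k<Suc m. r ^ Suc k * u (Suc k) a)"
      by (simp only: sum_distrib_left[symmetric] u_Suc)
    also have "\<dots> = w a - 1 + r ^ Suc m * u (Suc m) a"
      using \<open>w a = 1 + _\<close> by simp
    also have "\<dots> < w a"
    proof -
      have "r ^ Suc m * u (Suc m) a \<le> r ^ m * (real n * c)"
        using r u_bound[OF a] u_nonneg[OF a] by (intro mult_mono) (auto simp: mult_le_cancel_right1)
      then show ?thesis using m by simp
    qed
    finally show "(\<Sum>b<n. A $$ (a, b) * w b) < w a" .
  qed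
qed

text \<open>
  The same weights for a matrix indexed by an arbitrary finite set, with the strict inequalities
  condensed into one contraction factor \<open>c\<close>.
\<close>

lemma indexed_mat_weights:
  fixes M :: "nat \<Rightarrow> nat \<Rightarrow> real"
  assumes J: "finite J" "J \<noteq> {}" and nonneg: "\<And>i j. i \<in> J \<Longrightarrow> j \<in> J \<Longrightarrow> 0 \<le> M j i"
    and sr: "spec_rad (indexed_mat J M) < 1"
  obtains w c where "\<And>j. j \<in> J \<Longrightarrow> 0 < w j" "0 \<le> c" "c < 1"
    "\<And>j. j \<in> J \<Longrightarrow> (\<Sum>i\<in>J. M j i * w i) \<le> c * w j"
proof -
  have bij: "bij_betw (enum_idx J) {..<card J} J"
    unfolding enum_idx_def using J(1) by (intro bij_betw_nth) auto
  have mem: "enum_idx J a \<in> J" if "a < card J" for a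
    using bij that by (auto simp: bij_betw_def)
  have entry: "indexed_mat J M $$ (a, b) = M (enum_idx J a) (enum_idx J b)" if "a < card J" "b < card J" for a b
    using that by (simp add: indexed_mat_def)
  have "indexed_mat J M \<in> carrier_mat (card J) (card J)"
    by (simp add: indexed_mat_def)
  moreover have "0 \<le> indexed_mat J M $$ (a, b)" if "a < card J" "b < card J" for a b
    using that by (simp add: entry nonneg mem)
  ultimately obtain v where v: "\<And>a. a < card J \<Longrightarrow> 0 < v a"
    "\<And>a. a < card J \<Longrightarrow> (\<Sum>b<card J. indexed_mat J M $$ (a, b) * v b) < v a"
    using spec_rad_less_1_weights[OF _ sr] by blast
  define w where "w j = v (the_inv_into {..<card J} (enum_idx J) j)" for j
  have w: "w (enum_idx J a) = v a" if "a < card J" for a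
    using that bij unfolding w_def by (subst the_inv_into_f_f) (auto simp: bij_betw_def)
  have pos: "0 < w j" and less: "(\<Sum>i\<in>J. M j i * w i) < w j" if j: "j \<in> J" for j
  proof -
    obtain a where a: "a < card J" "j = enum_idx J a" using j bij by (fastforce simp: bij_betw_def)
    then show "0 < w j" using v w by simp
    have "(\<Sum>i\<in>J. M j i * w i) = (\<Sum>b<card J. indexed_mat J M $$ (a, b) * v b)"
      unfolding sum.reindex_bij_betw[OF bij, symmetric] using a by (intro sum.cong) (auto simp: entry w)
    then show "(\<Sum>i\<in>J. M j i * w i) < w j" using v a w by simp
  qed
  define c where "c = Max ((\<lambda>j. (\<Sum>i\<in>J. M j i * w i) / w j) ` J)"
  have c_ge: "(\<Sum>i\<in>J. M j i * w i) / w j \<le> c" if "j \<in> J" for j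
    unfolding c_def using that J by (intro Max_ge) auto
  show ?thesis
  proof (rule that)
    show "c < 1" unfolding c_def using J pos less by (auto simp: divide_less_eq)
    obtain j where j: "j \<in> J" using J by auto
    have "0 \<le> (\<Sum>i\<in>J. M j i * w i) / w j"
      using j nonneg pos by (intro divide_nonneg_pos sum_nonneg mult_nonneg_nonneg) (auto intro: less_imp_le)
    then show "0 \<le> c" using c_ge[OF j] by linarith
    show "(\<Sum>i\<in>J. M j i * w i) \<le> c * w j" if "j \<in> J" for j
      using c_ge[OF that] pos[OF that] by (simp add: field_simps)
  qed (use pos in auto)
qed

section \<open>Contractions in a weighted maximum metric\<close>

lemma dmax_tendsto_0:
  assumes J: "finite J" "J \<noteq> {}" and ms: "\<And>i. i \<in> J \<Longrightarrow> Metric_space (carr N i) (metr N i)"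
    and lim: "\<And>i. i \<in> J \<Longrightarrow> (\<lambda>k. metr N i (x k i) (z i)) \<longlonglongrightarrow> 0"
  shows "(\<lambda>k. dmax N J (x k) z) \<longlonglongrightarrow> 0"
proof (rule tendsto_sandwich[OF _ _ tendsto_const])
  show "(\<lambda>k. \<Sum>i\<in>J. metr N i (x k i) (z i)) \<longlonglongrightarrow> 0"
    using tendsto_sum[of J "\<lambda>i k. metr N i (x k i) (z i)" "\<lambda>_. 0" sequentially] lim by simp
  show "\<forall>\<^sub>F k in sequentially. 0 \<le> dmax N J (x k) z"
    unfolding dmax_def using J ms by (intro always_eventually) (auto simp: Max_ge_iff dest: Metric_space.nonneg)
  show "\<forall>\<^sub>F k in sequentially. dmax N J (x k) z \<le> (\<Sum>i\<in>J. metr N i (x k i) (z i))"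
    unfolding dmax_def using J ms
    by (intro always_eventually) (auto intro!: member_le_sum intro: Metric_space.nonneg)
qed

text \<open>
  Banach's fixed point theorem on a product of different complete metric spaces, for the weighted
  maximum metric with weights \<open>w\<close>.  That metric is never formed: the hypothesis \<open>contr\<close> says that
  \<open>G\<close> shrinks distances in it by the factor \<open>c\<close>, and working with one coordinate at a time leaves
  only completeness of the factors to be used.
\<close>

lemma weighted_contraction_attracts:
  fixes N :: "'a network"
  assumes J: "finite J" "J \<noteq> {}"
    and sp: "\<And>i. i \<in> J \<Longrightarrow> carr N i \<noteq> {} \<and> Metric_space (carr N i) (metr N i) \<and>
               Metric_space.mcomplete (carr N i) (metr N i)"
    and G: "\<And>x. x \<in> prod_space N J \<Longrightarrow> G x \<in> prod_space N J"
    and w: "\<And>i. i \<in> J \<Longrightarrow> 0 < w i" and c: "0 \<le> c" "c < 1"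
    and contr: "\<And>x y t j. x \<in> prod_space N J \<Longrightarrow> y \<in> prod_space N J \<Longrightarrow> 0 \<le> t \<Longrightarrow>
       (\<And>i. i \<in> J \<Longrightarrow> metr N i (x i) (y i) \<le> t * w i) \<Longrightarrow> j \<in> J \<Longrightarrow>
       metr N j (G x j) (G y j) \<le> c * t * w j"
  shows "\<exists>z. globally_attracting_fixed_point N J G z"
proof -
  have ms: "Metric_space (carr N i) (metr N i)" if "i \<in> J" for i using sp that by blast
  note nonneg = Metric_space.nonneg[OF ms]
  note comm = Metric_space.commute[OF ms]
  have inC: "x i \<in> carr N i" if "x \<in> prod_space N J" "i \<in> J" for x i
    using that by (auto simp: prod_space_def PiE_def)
  have iter: "(G ^^ k) x \<in> prod_space N J" if "x \<in> prod_space N J" for k x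
    using that G by (induction k) auto
  \<comment> \<open>The sum bounds the weighted maximum from above, and its convergence to \<open>0\<close> along a
    coordinatewise convergent sequence is immediate.\<close>
  define D where "D x y = (\<Sum>i\<in>J. metr N i (x i) (y i) / w i)" for x y :: "nat \<Rightarrow> 'a"
  have D_nonneg: "0 \<le> D x y" for x y
    unfolding D_def using w nonneg by (intro sum_nonneg divide_nonneg_pos) auto
  have D_bound: "metr N i (x i) (y i) \<le> D x y * w i" if "i \<in> J" for i x y
  proof -
    have "metr N i (x i) (y i) / w i \<le> D x y"
      unfolding D_def using that J w nonneg by (intro member_le_sum divide_nonneg_pos) auto
    then show ?thesis using w[OF that] by (simp add: field_simps)
  qed
  have iter_contr: "metr N i ((G ^^ k) x i) ((G ^^ k) y i) \<le> c ^ k * t * w i"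
    if x: "x \<in> prod_space N J" and y: "y \<in> prod_space N J" and t: "0 \<le> t"
      and b: "\<And>i. i \<in> J \<Longrightarrow> metr N i (x i) (y i) \<le> t * w i" and i: "i \<in> J" for x y t k i
    using i
  proof (induction k arbitrary: i)
    case (Suc k)
    have "metr N i (G ((G ^^ k) x) i) (G ((G ^^ k) y) i) \<le> c * (c ^ k * t) * w i"
      using Suc c t by (intro contr iter x y) auto
    then show ?case by (simp add: mult.assoc)
  qed (use b in simp)
  obtain y where y: "y \<in> prod_space N J"
    using sp by (fastforce simp: prod_space_def PiE_eq_empty_iff ex_in_conv[symmetric] simp del: ex_in_conv)
  \<comment> \<open>\<open>B\<close> is the sum of the geometric series of step lengths: it bounds the weighted distance from
    \<open>y\<close> to every point of its orbit, because it solves \<open>D y (G y) + c B = B\<close>.\<close>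
  define B where "B = D y (G y) / (1 - c)"
  have B: "0 \<le> B" "D y (G y) + c * B = B"
    using D_nonneg[of y "G y"] c by (auto simp: B_def field_simps)
  have orbit: "metr N i (y i) ((G ^^ m) y i) \<le> B * w i" if "i \<in> J" for m i
    using that
  proof (induction m arbitrary: i)
    case 0
    then show ?case using B w inC[OF y] by (simp add: Metric_space.mdist_zero[OF ms] less_imp_le)
  next
    case (Suc m)
    have "metr N i (y i) ((G ^^ Suc m) y i)
        \<le> metr N i (y i) (G y i) + metr N i (G y i) (G ((G ^^ m) y) i)"
      using Suc.prems by (auto intro!: Metric_space.triangle[OF ms] inC y G iter)
    also have "\<dots> \<le> D y (G y) * w i + c * B * w i"
      using Suc B by (intro add_mono D_bound contr y iter) auto
    also have "\<dots> = B * w i" by (metis B(2) distrib_right)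
    finally show ?case .
  qed
  have lim0: "(\<lambda>k. c ^ k * t * s) \<longlonglongrightarrow> 0" for t s :: real
    using tendsto_mult[OF tendsto_mult[OF LIMSEQ_realpow_zero[OF c] tendsto_const] tendsto_const, of t s] by simp
  have cauchy: "Metric_space.MCauchy (carr N i) (metr N i) (\<lambda>k. (G ^^ k) y i)" if i: "i \<in> J" for i
    unfolding Metric_space.MCauchy_def[OF ms[OF i]]
  proof (intro conjI allI impI)
    show "range (\<lambda>k. (G ^^ k) y i) \<subseteq> carr N i" using iter[OF y] inC i by auto
    fix e :: real assume "0 < e"
    then have "\<forall>\<^sub>F k in sequentially. c ^ k * B * w i < e"
      by (intro order_tendstoD(2)[OF lim0])
    then obtain K where K: "\<And>k. K \<le> k \<Longrightarrow> c ^ k * B * w i < e"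
      by (auto simp: eventually_sequentially)
    have *: "metr N i ((G ^^ k) y i) ((G ^^ k') y i) < e" if "K \<le> k" "k \<le> k'" for k k'
    proof -
      have "metr N i ((G ^^ k) y i) ((G ^^ k) ((G ^^ (k' - k)) y) i) \<le> c ^ k * B * w i"
        using orbit B i by (intro iter_contr y iter) auto
      also have "(G ^^ k) ((G ^^ (k' - k)) y) = (G ^^ k') y"
        using that by (simp add: funpow_add[symmetric, THEN fun_cong, unfolded comp_apply])
      finally show ?thesis using K[OF that(1)] by simp
    qed
    show "\<exists>K. \<forall>k k'. K \<le> k \<longrightarrow> K \<le> k' \<longrightarrow> metr N i ((G ^^ k) y i) ((G ^^ k') y i) < e"
      using * comm[OF i] by (metis nle_le)
  qed
  have "\<exists>a. limitin (Metric_space.mtopology (carr N i) (metr N i)) (\<lambda>k. (G ^^ k) y i) a sequentially"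
    if "i \<in> J" for i
    using cauchy[OF that] sp[OF that] Metric_space.mcomplete_def[OF ms[OF that]] by blast
  then obtain z' where "\<And>i. i \<in> J \<Longrightarrow>
      limitin (Metric_space.mtopology (carr N i) (metr N i)) (\<lambda>k. (G ^^ k) y i) (z' i) sequentially"
    by metis
  then have z': "z' i \<in> carr N i" "(\<lambda>k. metr N i ((G ^^ k) y i) (z' i)) \<longlonglongrightarrow> 0" if "i \<in> J" for i
    using Metric_space.limitin_metric_dist_null[OF ms[OF that], THEN iffD1] that by blast+
  define z where "z = restrict z' J"
  have z: "z \<in> prod_space N J" using z' by (auto simp: z_def prod_space_def)
  have lim: "(\<lambda>k. metr N i ((G ^^ k) y i) (z i)) \<longlonglongrightarrow> 0" if "i \<in> J" for i
    using z'(2)[OF that] that by (simp add: z_def)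
  have "(\<lambda>k. D ((G ^^ k) y) z) \<longlonglongrightarrow> (\<Sum>i\<in>J. 0 / w i)"
    unfolding D_def using w by (intro tendsto_intros lim) (auto simp: less_imp_neq[symmetric])
  then have Dlim: "(\<lambda>k. D ((G ^^ k) y) z) \<longlonglongrightarrow> 0" by simp
  have "G z i = z i" if i: "i \<in> J" for i
  proof -
    have "(\<lambda>k. c * D ((G ^^ k) y) z * w i + metr N i ((G ^^ Suc k) y i) (z i)) \<longlonglongrightarrow> c * 0 * w i + 0"
      by (intro tendsto_intros Dlim LIMSEQ_Suc[OF lim[OF i]])
    moreover have "metr N i (G z i) (z i) \<le> c * D ((G ^^ k) y) z * w i + metr N i ((G ^^ Suc k) y i) (z i)" for k
    proof -
      have "metr N i (G z i) (z i) \<le> metr N i (G ((G ^^ k) y) i) (G z i) + metr N i (G ((G ^^ k) y) i) (z i)"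
        using Metric_space.triangle[OF ms[OF i], of "G z i" "G ((G ^^ k) y) i" "z i"] comm[OF i]
          inC[OF z i] inC[OF G[OF z] i] inC[OF G[OF iter[OF y, of k]] i] by simp
      also have "metr N i (G ((G ^^ k) y) i) (G z i) \<le> c * D ((G ^^ k) y) z * w i"
        using i by (intro contr iter y z D_nonneg D_bound)
      finally show ?thesis by simp
    qed
    ultimately have "metr N i (G z i) (z i) \<le> 0"
      by (intro LIMSEQ_le_const) auto
    then show ?thesis
      using nonneg[OF i, of "G z i" "z i"] Metric_space.zero[OF ms[OF i] inC[OF G[OF z] i] inC[OF z i]] by simp
  qed
  then have fixed: "G z = z"
    using G[OF z] z by (auto simp: prod_space_def intro: PiE_ext)
  have iter_z: "(G ^^ k) z = z" for k by (induction k) (auto simp: fixed)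
  have "(\<lambda>k. dmax N J ((G ^^ k) x) z) \<longlonglongrightarrow> 0" if x: "x \<in> prod_space N J" for x
  proof (rule dmax_tendsto_0[OF J ms])
    fix i assume i: "i \<in> J"
    show "(\<lambda>k. metr N i ((G ^^ k) x i) (z i)) \<longlonglongrightarrow> 0"
    proof (rule tendsto_sandwich[OF _ _ tendsto_const])
      show "(\<lambda>k. c ^ k * D x z * w i) \<longlonglongrightarrow> 0" by (rule lim0)
      show "\<forall>\<^sub>F k in sequentially. metr N i ((G ^^ k) x i) (z i) \<le> c ^ k * D x z * w i"
        using iter_contr[OF x z D_nonneg D_bound i] by (simp add: iter_z)
    qed (use nonneg i in auto)
  qed
  then show ?thesis
    unfolding globally_attracting_fixed_point_def using z fixed by blast
qed

text \<open>
  Delays do not destroy a contraction, they only slow it down: looking back at most \<open>d\<close> steps costs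
  at most one block of length \<open>d\<close>, so each block of \<open>d\<close> steps gains a factor \<open>c\<close>.
\<close>

lemma delayed_contraction_tendsto_0:
  fixes e :: "nat \<Rightarrow> nat \<Rightarrow> real" and M :: "nat \<Rightarrow> nat \<Rightarrow> real"
  assumes J: "finite J" and w: "\<And>j. j \<in> J \<Longrightarrow> 0 < w j" and c: "0 \<le> c" "c < 1"
    and M: "\<And>i j. i \<in> J \<Longrightarrow> j \<in> J \<Longrightarrow> 0 \<le> M j i" "\<And>j. j \<in> J \<Longrightarrow> (\<Sum>i\<in>J. M j i * w i) \<le> c * w j"
    and \<tau>: "\<And>i j. j \<in> J \<Longrightarrow> 1 \<le> \<tau> j i \<and> \<tau> j i \<le> d"
    and e0: "\<And>t j. j \<in> J \<Longrightarrow> 0 \<le> e t j"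
    and e: "\<And>t j. j \<in> J \<Longrightarrow> d \<le> t \<Longrightarrow> e t j \<le> (\<Sum>i\<in>J. M j i * e (t - \<tau> j i) i)"
    and j: "j \<in> J"
  shows "(\<lambda>t. e t j) \<longlonglongrightarrow> 0"
proof -
  have d: "1 \<le> d" using \<tau>[OF j, of j] by linarith
  \<comment> \<open>\<open>C\<close> absorbs the first \<open>d\<close> values, for which the recursive bound \<open>e\<close> is not available.\<close>
  define C where "C = (\<Sum>t<d. \<Sum>i\<in>J. e t i / w i)"
  have q: "0 \<le> e t i / w i" if "i \<in> J" for t i using e0 w that by (simp add: less_imp_le)
  have C: "e t i \<le> C * w i" if "i \<in> J" "t < d" for t i
  proof -
    have "e t i / w i \<le> (\<Sum>i\<in>J. e t i / w i)"
      using that J q by (intro member_le_sum) auto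
    also have "\<dots> \<le> C"
      unfolding C_def using that q
      by (intro member_le_sum[of t "{..<d}" "\<lambda>t. \<Sum>i\<in>J. e t i / w i"] sum_nonneg) auto
    finally show ?thesis using w[OF that(1)] by (simp add: field_simps)
  qed
  have C0: "0 \<le> C" unfolding C_def using q by (intro sum_nonneg) auto
  have bound: "e t j \<le> C * c ^ (t div d) * w j" if "j \<in> J" for t j
    using that
  proof (induction t arbitrary: j rule: less_induct)
    case (less t)
    show ?case
    proof (cases "t < d")
      case True
      then show ?thesis using C less.prems by simp
    next
      case False
      then have td: "t div d = Suc ((t - d) div d)" using d by (simp add: le_div_geq)
      have "e t j \<le> (\<Sum>i\<in>J. M j i * e (t - \<tau> j i) i)" using e False less.prems by simp
      also have "\<dots> \<le> (\<Sum>i\<in>J. M j i * (C * c ^ ((t - d) div d) * w i))"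
      proof (intro sum_mono mult_left_mono M)
        fix i assume i: "i \<in> J"
        have "e (t - \<tau> j i) i \<le> C * c ^ ((t - \<tau> j i) div d) * w i"
          using \<tau>[OF less.prems, of i] False d i by (intro less.IH) auto
        also have "\<dots> \<le> C * c ^ ((t - d) div d) * w i"
          using \<tau>[OF less.prems, of i] c C0 w[OF i]
          by (intro mult_right_mono mult_left_mono power_decreasing div_le_mono diff_le_mono2) auto
        finally show "e (t - \<tau> j i) i \<le> C * c ^ ((t - d) div d) * w i" .
      qed (use less.prems in auto)
      also have "\<dots> = C * c ^ ((t - d) div d) * (\<Sum>i\<in>J. M j i * w i)"
        by (simp add: sum_distrib_left mult_ac)
      also have "\<dots> \<le> C * c ^ ((t - d) div d) * (c * w j)"
        using C0 c M(2)[OF less.prems] by (intro mult_left_mono) auto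
      finally show ?thesis by (simp add: td mult_ac)
    qed
  qed
  show ?thesis
  proof (rule tendsto_sandwich[OF _ _ tendsto_const])
    have "filterlim (\<lambda>t. t div d) at_top sequentially"
    proof (rule filterlim_at_top_mono[of "\<lambda>t. t div d"], unfold filterlim_at_top, intro allI)
      fix m
      show "\<forall>\<^sub>F t in sequentially. m \<le> t div d"
        using d by (intro eventually_sequentiallyI[of "m * d"]) (simp add: less_eq_div_iff_mult_less_eq)
    qed auto
    then have "(\<lambda>t. c ^ (t div d)) \<longlonglongrightarrow> 0"
      by (rule filterlim_compose[OF LIMSEQ_realpow_zero[OF c]])
    then show "(\<lambda>t. C * c ^ (t div d) * w j) \<longlonglongrightarrow> 0"
      by (intro tendsto_mult_left_zero tendsto_mult_right_zero)
  qed (use bound e0 j in auto)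
qed

section \<open>Components and their iterated substitution\<close>

locale network_setting =
  fixes N :: "'a network"
  assumes dyn: "dynamical_network N"
begin

lemma finite_idx: "finite (idx N)" by (simp add: idx_def)

lemma component_space:
  assumes "i \<in> idx N"
  shows "carr N i \<noteq> {}" "Metric_space (carr N i) (metr N i)"
    "Metric_space.mcomplete (carr N i) (metr N i)"
  using dyn assms by (auto simp: dynamical_network_def)

lemma nbrs_subset_idx: "j \<in> idx N \<Longrightarrow> nbrs N j \<subseteq> idx N"
  using dyn by (auto simp: dynamical_network_def)

lemma loc_in_carr: "i \<in> idx N \<Longrightarrow> a \<in> carr N i \<Longrightarrow> loc N i a \<in> carr N i"
  using dyn by (auto simp: dynamical_network_def)

lemma lip_const_nonneg:
  assumes "i \<in> idx N"
  shows "0 \<le> lip_const N i"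
  using dyn assms unfolding lip_const_def dynamical_network_def by (intro cSup_upper) auto

lemma loc_lipschitz:
  assumes i: "i \<in> idx N" and a: "a \<in> carr N i" and b: "b \<in> carr N i"
  shows "metr N i (loc N i a) (loc N i b) \<le> lip_const N i * metr N i a b"
proof (cases "a = b")
  case True
  then show ?thesis
    using Metric_space.mdist_zero[OF component_space(2)[OF i]] loc_in_carr[OF i] a by simp
next
  case False
  have "metr N i (loc N i a) (loc N i b) / metr N i a b \<in> lip_ratios N i"
    using a b False by (auto simp: lip_ratios_def)
  then have "metr N i (loc N i a) (loc N i b) / metr N i a b \<le> lip_const N i"
    using dyn i unfolding lip_const_def dynamical_network_def by (intro cSup_upper) auto
  moreover have "0 < metr N i a b"
    using Metric_space.mdist_pos_eq[OF component_space(2)[OF i] a b] False by simp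
  ultimately show ?thesis by (simp add: field_simps)
qed

lemma component_in_carr:
  assumes j: "j \<in> idx N" and x: "\<And>i. i \<in> nbrs N j \<Longrightarrow> x i \<in> carr N i"
  shows "component N j x \<in> carr N j"
proof -
  have "continuous_map
          (product_topology (\<lambda>i. Metric_space.mtopology (carr N i) (metr N i)) (nbrs N j))
          (Metric_space.mtopology (carr N j) (metr N j)) (inter N j)"
    using dyn j by (auto simp: dynamical_network_def)
  moreover have top: "topspace (Metric_space.mtopology (carr N i) (metr N i)) = carr N i" if "i \<in> idx N" for i
    using Metric_space.topspace_mtopology[OF component_space(2)[OF that]] .
  have "(\<lambda>i\<in>nbrs N j. loc N i (x i)) \<in>
      topspace (product_topology (\<lambda>i. Metric_space.mtopology (carr N i) (metr N i)) (nbrs N j))"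
    using nbrs_subset_idx[OF j] x by (auto simp: top loc_in_carr subset_iff)
  ultimately show ?thesis
    unfolding component_def using top[OF j] by (auto simp: continuous_map_def Pi_iff)
qed

lemma component_cong:
  assumes "\<And>i. i \<in> nbrs N j \<Longrightarrow> x i = y i"
  shows "component N j x = component N j y"
  unfolding component_def using assms by (simp cong: restrict_cong)

lemma network_map_apply:
  assumes "j \<in> idx N"
  shows "network_map N x j = component N j x"
  by (subst network_map_component[OF dyn assms]) (auto intro: component_cong)

lemma network_map_prod_space:
  assumes "x \<in> prod_space N (idx N)"
  shows "network_map N x \<in> prod_space N (idx N)"
  unfolding prod_space_def
proof (rule PiE_I)
  fix j assume j: "j \<in> idx N"
  show "network_map N x j \<in> carr N j"
    unfolding network_map_apply[OF j] using nbrs_subset_idx[OF j] assms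
    by (intro component_in_carr j) (auto simp: prod_space_def)
qed (simp add: network_map_def interaction_def)

text \<open>
  The bounds in \<^const>\<open>lip_bounds\<close> speak of points of the full product, whereas a component only
  sees its neighbours; the remaining coordinates are filled in arbitrarily, which is possible
  because the carriers are nonempty.
\<close>

lemma component_lipschitz:
  assumes L: "lip_bounds N \<Lambda>" and j: "j \<in> idx N"
    and x: "\<And>i. i \<in> nbrs N j \<Longrightarrow> x i \<in> carr N i" and y: "\<And>i. i \<in> nbrs N j \<Longrightarrow> y i \<in> carr N i"
  shows "metr N j (component N j x) (component N j y)
       \<le> (\<Sum>i\<in>nbrs N j. \<Lambda> i j * lip_const N i * metr N i (x i) (y i))"
proof -
  have sub: "nbrs N j \<subseteq> idx N" by (rule nbrs_subset_idx[OF j])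
  define e where "e x = (\<lambda>i\<in>idx N. if i \<in> nbrs N j then loc N i (x i) else SOME a. a \<in> carr N i)" for x
  have e: "e x \<in> prod_space N (idx N)" if "\<And>i. i \<in> nbrs N j \<Longrightarrow> x i \<in> carr N i" for x
    using that loc_in_carr component_space(1) by (auto simp: e_def prod_space_def some_in_eq)
  have c: "component N j x = inter N j (restrict (e x) (nbrs N j))" for x
    unfolding component_def e_def using sub by (intro arg_cong[where f = "inter N j"]) (auto simp: restrict_def fun_eq_iff)
  have "metr N j (component N j x) (component N j y) \<le> (\<Sum>i\<in>nbrs N j. \<Lambda> i j * metr N i (e x i) (e y i))"
    unfolding c using L j e[OF x] e[OF y] by (auto simp: lip_bounds_def)
  also have "\<dots> \<le> (\<Sum>i\<in>nbrs N j. \<Lambda> i j * (lip_const N i * metr N i (x i) (y i)))"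
  proof (intro sum_mono mult_left_mono)
    fix i assume i: "i \<in> nbrs N j"
    then have "i \<in> idx N" using sub by auto
    then show "metr N i (e x i) (e y i) \<le> lip_const N i * metr N i (x i) (y i)"
      using loc_lipschitz x y i by (auto simp: e_def)
    show "0 \<le> \<Lambda> i j" using L \<open>i \<in> idx N\<close> j by (auto simp: lip_bounds_def)
  qed
  finally show ?thesis by (simp add: mult.assoc)
qed

lemma subst_vars_subset_idx:
  assumes j: "j \<in> idx N"
  shows "subst_vars N S j k \<subseteq> idx N"
  by (induction k) (use nbrs_subset_idx j in fastforce)+

lemma subst_fun_cong:
  assumes "\<And>i. i \<in> subst_vars N S j k \<Longrightarrow> x i = y i"
  shows "subst_fun N S j k x = subst_fun N S j k y"
  using assms
proof (induction k arbitrary: x y)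
  case 0
  then show ?case by (auto intro: component_cong)
next
  case (Suc k)
  show ?case unfolding subst_fun.simps
  proof (rule Suc.IH)
    fix i assume i: "i \<in> subst_vars N S j k"
    show "(\<lambda>l\<in>subst_vars N S j k. if l \<in> S then x l else component N l x) i
        = (\<lambda>l\<in>subst_vars N S j k. if l \<in> S then y l else component N l y) i"
      using i Suc.prems by (auto intro!: component_cong)
  qed
qed

lemma subst_fun_in_carr:
  assumes j: "j \<in> idx N" and "\<And>i. i \<in> subst_vars N S j k \<Longrightarrow> x i \<in> carr N i"
  shows "subst_fun N S j k x \<in> carr N j"
  using assms(2)
proof (induction k arbitrary: x)
  case 0
  then show ?case using j by (auto intro: component_in_carr)
next
  case (Suc k)
  show ?case unfolding subst_fun.simps
  proof (rule Suc.IH)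
    fix i assume i: "i \<in> subst_vars N S j k"
    then have "i \<in> idx N" using subst_vars_subset_idx[OF j] by auto
    then show "(\<lambda>l\<in>subst_vars N S j k. if l \<in> S then x l else component N l x) i \<in> carr N i"
      using i Suc.prems by (auto intro!: component_in_carr)
  qed
qed

text \<open>
  Substituting a component for a variable replaces a distance at most \<open>t w\<close> by one at most
  \<open>c t w \<le> t w\<close>.  Hence substitution preserves the weighted Lipschitz bound of a component, whatever
  the number of substitution steps: the weights found for the whole network also serve its
  restriction.
\<close>

lemma subst_fun_contraction:
  assumes L: "lip_bounds N \<Lambda>" and w: "\<And>i. i \<in> idx N \<Longrightarrow> 0 < w i" and c: "c \<le> 1" and t: "0 \<le> t"
    and Mw: "\<And>j. j \<in> idx N \<Longrightarrow> (\<Sum>i\<in>idx N. \<Lambda> i j * lip_const N i * w i) \<le> c * w j"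
    and j: "j \<in> idx N"
    and "\<And>i. i \<in> subst_vars N S j k \<Longrightarrow> x i \<in> carr N i"
    and "\<And>i. i \<in> subst_vars N S j k \<Longrightarrow> y i \<in> carr N i"
    and "\<And>i. i \<in> subst_vars N S j k \<Longrightarrow> metr N i (x i) (y i) \<le> t * w i"
  shows "metr N j (subst_fun N S j k x) (subst_fun N S j k y) \<le> c * t * w j"
proof -
  have comp: "metr N j (component N j x) (component N j y) \<le> c * t * w j"
    if j: "j \<in> idx N" and x: "\<And>i. i \<in> nbrs N j \<Longrightarrow> x i \<in> carr N i"
      and y: "\<And>i. i \<in> nbrs N j \<Longrightarrow> y i \<in> carr N i"
      and b: "\<And>i. i \<in> nbrs N j \<Longrightarrow> metr N i (x i) (y i) \<le> t * w i" for j x y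
  proof -
    have nonneg: "0 \<le> \<Lambda> i j * lip_const N i" if "i \<in> idx N" for i
      using L that j lip_const_nonneg[OF that] by (auto simp: lip_bounds_def)
    have "metr N j (component N j x) (component N j y)
        \<le> (\<Sum>i\<in>nbrs N j. \<Lambda> i j * lip_const N i * metr N i (x i) (y i))"
      by (rule component_lipschitz[OF L j x y])
    also have "\<dots> \<le> (\<Sum>i\<in>nbrs N j. \<Lambda> i j * lip_const N i * (t * w i))"
      using nbrs_subset_idx[OF j] by (intro sum_mono mult_left_mono b nonneg) auto
    also have "\<dots> \<le> (\<Sum>i\<in>idx N. \<Lambda> i j * lip_const N i * (t * w i))"
    proof (rule sum_mono2[OF finite_idx nbrs_subset_idx[OF j]])
      fix i assume "i \<in> idx N - nbrs N j"
      then show "0 \<le> \<Lambda> i j * lip_const N i * (t * w i)"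
        using nonneg[of i] t w[of i] by (intro mult_nonneg_nonneg[of _ "t * w i"]) auto
    qed
    also have "\<dots> = t * (\<Sum>i\<in>idx N. \<Lambda> i j * lip_const N i * w i)"
      by (simp add: sum_distrib_left mult_ac)
    also have "\<dots> \<le> t * (c * w j)"
      using Mw[OF j] t by (rule mult_left_mono)
    finally show ?thesis by (simp add: mult_ac)
  qed
  show ?thesis using assms(7-9)
  proof (induction k arbitrary: x y)
    case 0
    then show ?case using j by (auto intro: comp)
  next
    case (Suc k)
    note sub = subst_vars_subset_idx[OF j, of S k]
    show ?case unfolding subst_fun.simps
    proof (rule Suc.IH)
      fix i assume i: "i \<in> subst_vars N S j k"
      let ?e = "\<lambda>x. \<lambda>l\<in>subst_vars N S j k. if l \<in> S then x l else component N l x"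
      have i': "i \<in> idx N" using i sub by auto
      show "?e x i \<in> carr N i" using i i' Suc.prems(1) by (auto intro!: component_in_carr)
      show "?e y i \<in> carr N i" using i i' Suc.prems(2) by (auto intro!: component_in_carr)
      show "metr N i (?e x i) (?e y i) \<le> t * w i"
      proof (cases "i \<in> S")
        case True
        then show ?thesis using i Suc.prems(3) by simp
      next
        case False
        then have "metr N i (?e x i) (?e y i) \<le> c * t * w i"
          using i i' Suc.prems by (auto intro!: comp)
        also have "\<dots> = c * (t * w i)" by simp
        also have "\<dots> \<le> t * w i"
          using mult_right_mono[OF c, of "t * w i"] t w[OF i'] by simp
        finally show ?thesis .
      qed
    qed
  qed
qed

text \<open>
  At a point where the components outside \<open>S\<close> are already consistent, a substitution changes
  nothing.  This makes fixed points of the restriction and of the network correspond.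
\<close>

lemma subst_fun_fixed:
  assumes j: "j \<in> idx N" and z: "\<And>l. l \<in> idx N - S \<Longrightarrow> component N l z = z l"
  shows "subst_fun N S j k z = component N j z"
proof (induction k)
  case (Suc k)
  have "subst_fun N S j (Suc k) z = subst_fun N S j k z"
    unfolding subst_fun.simps using subst_vars_subset_idx[OF j, of S k] z
    by (intro subst_fun_cong) auto
  then show ?case using Suc by simp
qed simp

end

section \<open>Branches as time delays\<close>

text \<open>
  Cutting out closed detours; the set \<open>W\<close> records where the path stays.
\<close>

lemma vpath_of_rtrancl:
  assumes "(u, v) \<in> r\<^sup>*" and r: "r \<subseteq> arcs_ends G" "Field r \<subseteq> W" "W \<subseteq> verts G" and v: "v \<in> W"
  shows "\<exists>p. vpath p G \<and> hd p = u \<and> last p = v \<and> set p \<subseteq> W"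
  using assms(1)
proof (induction rule: converse_rtrancl_induct)
  case base
  have "vpath [v] G" using v r by (auto simp: vpath_def vwalk_def)
  then show ?case using v by (intro exI[of _ "[v]"]) auto
next
  case (step a b)
  then obtain p where p: "vpath p G" "hd p = b" "last p = v" "set p \<subseteq> W" by blast
  have a: "a \<in> W" "(a, b) \<in> arcs_ends G" using step(1) r by (auto simp: Field_def)
  show ?case
  proof (cases "a \<in> set p")
    case True
    then obtain q s where p_eq: "p = q @ a # s" by (auto dest: split_list)
    have "vpath (a # s) G"
      using p(1) vwalkI_append_r[of "a # s" q G] unfolding p_eq vpath_def by auto
    then show ?thesis using p unfolding p_eq by (intro exI[of _ "a # s"]) auto
  next
    case False
    have "p \<noteq> []" using p by (auto simp: vpath_def vwalk_def)
    then have "vpath (a # p) G"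
      using p a r False by (auto simp: vpath_def intro!: vwalk_consI)
    then show ?thesis using p a \<open>p \<noteq> []\<close> by (intro exI[of _ "a # p"]) auto
  qed
qed

locale basic_structural_setting = network_setting N for N :: "'a network" +
  fixes S :: "nat set"
  assumes bss: "basic_structural_set (interaction_graph N) S"
begin

abbreviation "\<Gamma> \<equiv> interaction_graph N"

lemma verts_graph: "verts \<Gamma> = idx N"
  by (simp add: interaction_graph_def)

lemma arcs_ends_graph: "(i, j) \<in> arcs_ends \<Gamma> \<longleftrightarrow> i \<in> idx N \<and> j \<in> idx N \<and> i \<in> nbrs N j"
  by (force simp: arcs_ends_def arc_to_ends_def interaction_graph_def)

lemma S_subset_idx: "S \<subseteq> idx N"
  and cycle_meets_S: "vcycle p \<Gamma> \<Longrightarrow> set p \<inter> S \<noteq> {}"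
  and S_nonempty: "S \<noteq> {}"
proof -
  have css: "complete_structural_set \<Gamma> S" using bss by (simp add: basic_structural_set_def)
  then show "S \<subseteq> idx N" "vcycle p \<Gamma> \<Longrightarrow> set p \<inter> S \<noteq> {}"
    by (auto simp: complete_structural_set_def verts_graph)
  have "1 \<in> idx N" using dyn by (simp add: dynamical_network_def idx_def)
  then show "S \<noteq> {}" using css by (force simp: complete_structural_set_def verts_graph)
qed

lemma in_idx: "j \<in> S \<Longrightarrow> j \<in> idx N" using S_subset_idx by auto

text \<open>
  Every cycle meets \<open>S\<close>, so the interaction graph without \<open>S\<close> is acyclic, and counting the
  ancestors of a vertex inside that graph gives a rank that increases along its edges.
\<close>

lemma rank_outside_S:
  obtains h :: "nat \<Rightarrow> nat" where
    "\<And>i l. l \<in> idx N - S \<Longrightarrow> i \<in> nbrs N l - S \<Longrightarrow> h i < h l"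
proof -
  define r where "r = {(i, l). i \<in> idx N - S \<and> l \<in> idx N - S \<and> i \<in> nbrs N l}"
  have r: "r \<subseteq> arcs_ends \<Gamma>" "Field r \<subseteq> idx N - S"
    by (auto simp: r_def Field_def arcs_ends_graph)
  have acyc: "(v, v) \<notin> r\<^sup>+" for v
  proof
    assume "(v, v) \<in> r\<^sup>+"
    then obtain u where u: "(v, u) \<in> r" "(u, v) \<in> r\<^sup>*" by (auto dest: tranclD)
    then have vS: "v \<in> idx N - S" by (auto simp: r_def)
    have "\<exists>p. vpath p \<Gamma> \<and> hd p = u \<and> last p = v \<and> set p \<subseteq> idx N - S"
      by (rule vpath_of_rtrancl[OF u(2) r _ vS]) (auto simp: verts_graph)
    then obtain p where p: "vpath p \<Gamma>" "hd p = u" "last p = v" "set p \<subseteq> idx N - S" by blast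
    have "p \<noteq> []" using p by (auto simp: vpath_def vwalk_def)
    have "vwalk (v # p) \<Gamma>"
      using p u r vS by (intro vwalk_consI) (auto simp: vpath_def verts_graph)
    then have "vcycle (v # p) \<Gamma>"
      using p \<open>p \<noteq> []\<close> by (auto simp: vcycle_def vpath_def Suc_le_eq)
    then have "set (v # p) \<inter> S \<noteq> {}" by (rule cycle_meets_S)
    then show False using p vS by auto
  qed
  have fin: "finite {i. (i, l) \<in> r\<^sup>+}" for l
    by (rule finite_subset[OF _ finite_idx]) (auto simp: r_def dest: tranclD)
  show ?thesis
  proof (rule that[of "\<lambda>l. card {i. (i, l) \<in> r\<^sup>+}"])
    fix i l assume l: "l \<in> idx N - S" and i: "i \<in> nbrs N l - S"
    then have il: "(i, l) \<in> r" using nbrs_subset_idx[of l] by (auto simp: r_def)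
    have "{k. (k, i) \<in> r\<^sup>+} \<subset> {k. (k, l) \<in> r\<^sup>+}"
      using il acyc[of i] by (auto intro: trancl_into_trancl)
    then show "card {k. (k, i) \<in> r\<^sup>+} < card {k. (k, l) \<in> r\<^sup>+}"
      by (rule psubset_card_mono[OF fin])
  qed
qed

text \<open>
  A variable that is still to be substituted after \<open>k\<close> steps was reached by walking backwards \<open>k + 1\<close>
  edges from \<open>j\<close> through vertices outside \<open>S\<close>.  Such a walk repeats no vertex, since ranks drop
  along the way back.
\<close>

lemma walk_to_subst_var:
  assumes j: "j \<in> S" and l: "l \<in> subst_vars N S j k - S"
  obtains p where "vwalk p \<Gamma>" "hd p = l" "last p = j" "length p = k + 2" "distinct p"
    "set (butlast p) \<inter> S = {}"
proof -
  obtain h where h: "\<And>i l. l \<in> idx N - S \<Longrightarrow> i \<in> nbrs N l - S \<Longrightarrow> h i < (h l :: nat)"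
    by (rule rank_outside_S) blast
  note j' = in_idx[OF j]
  \<comment> \<open>The last conjunct strengthens the induction: a vertex outside \<open>S\<close> put in front has a
    rank below all others outside \<open>S\<close>, so it does not occur yet.\<close>
  have "\<exists>p. vwalk p \<Gamma> \<and> hd p = l \<and> last p = j \<and> length p = k + 2 \<and> distinct p \<and>
    set (butlast p) \<inter> S = {} \<and> (\<forall>v\<in>set (butlast p). h l \<le> h v)"
    using l
  proof (induction k arbitrary: l)
    case 0
    then have "l \<in> idx N" using nbrs_subset_idx[OF j'] by auto
    then have "vwalk [l, j] \<Gamma>" using 0 j' by (auto simp: vwalk_def verts_graph arcs_ends_graph)
    then show ?case using 0 j by (intro exI[of _ "[l, j]"]) auto
  next
    case (Suc k)
    then obtain m where m: "m \<in> subst_vars N S j k - S" "l \<in> nbrs N m" "l \<notin> S" by auto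
    obtain p where p: "vwalk p \<Gamma>" "hd p = m" "last p = j" "length p = k + 2" "distinct p"
      "set (butlast p) \<inter> S = {}" "\<And>v. v \<in> set (butlast p) \<Longrightarrow> h m \<le> h v"
      using Suc.IH[OF m(1)] by blast
    have m': "m \<in> idx N" using m subst_vars_subset_idx[OF j'] by auto
    have l: "l \<in> idx N" using m nbrs_subset_idx[OF m'] by auto
    have lm: "h l < h m" using h m m' by blast
    have p0: "p \<noteq> []" using p by auto
    then have "set p = insert j (set (butlast p))"
      using p(3) by (metis append_butlast_last_id list.set(2) rotate1.simps(2) set_rotate1)
    moreover have "l \<notin> set (butlast p)" using p(7) lm by force
    ultimately have "l \<notin> set p" using m j by auto
    moreover have "vwalk (l # p) \<Gamma>"
      using p m l m' by (intro vwalk_consI) (auto simp: verts_graph arcs_ends_graph)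
    ultimately show ?case
      using p p0 m lm by (intro exI[of _ "l # p"]) (auto intro: less_imp_le less_le_trans)
  qed
  then show ?thesis using that by blast
qed

lemma subst_depth_bound:
  assumes "j \<in> S" "l \<in> subst_vars N S j k - S"
  shows "k + 2 \<le> dim N"
proof -
  obtain p where p: "vwalk p \<Gamma>" "length p = k + 2" "distinct p"
    using walk_to_subst_var[OF assms] by metis
  then have "card (set p) \<le> card (idx N)"
    by (intro card_mono finite_idx) (auto simp: vwalk_def verts_graph)
  then show ?thesis using p by (simp add: distinct_card idx_def)
qed

text \<open>
  Termination of the substitution process, which makes the least number of steps in
  \<^const>\<open>subst_depth\<close> meaningful.
\<close>

lemma restr_vars_subset_S:
  assumes "j \<in> S"
  shows "restr_vars N S j \<subseteq> S"
  unfolding restr_vars_def subst_depth_def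
proof (rule LeastI)
  show "subst_vars N S j (dim N) \<subseteq> S" using subst_depth_bound[OF assms, of _ "dim N"] by auto
qed

text \<open>
  This is where \<open>S\<close> has to be basic.  Each occurrence of a variable \<open>x_i\<close> in the restricted
  component \<open>j\<close> comes from a branch from \<open>i\<close> to \<open>j\<close>, and the information travels along that branch
  in as many time steps as it has edges.  A single branch means a single delay \<open>\<tau> i\<close>, common to all
  occurrences of \<open>x_i\<close>.
\<close>

lemma branch_delays:
  assumes j: "j \<in> S"
  obtains \<tau> where "\<And>i. 1 \<le> \<tau> i \<and> \<tau> i \<le> dim N" "\<And>i. i \<in> nbrs N j \<inter> S \<Longrightarrow> \<tau> i = 1"
    "\<And>k l i. l \<in> subst_vars N S j k - S \<Longrightarrow> i \<in> nbrs N l \<inter> S \<Longrightarrow> \<tau> i = k + 2"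
proof -
  note j' = in_idx[OF j]
  \<comment> \<open>Without a branch the variable does not occur; the value \<open>1\<close> keeps the delay between \<open>1\<close>
    and \<^term>\<open>dim N\<close>.\<close>
  define \<tau> where "\<tau> i = (if branches \<Gamma> S i j = {} then 1 else vwalk_length (SOME p. p \<in> branches \<Gamma> S i j))" for i
  have unique: "\<tau> i = vwalk_length p" if p: "p \<in> branches \<Gamma> S i j" and i: "i \<in> S" for i p
  proof -
    have "card (branches \<Gamma> S i j) \<le> 1" using bss i j by (simp add: basic_structural_set_def)
    moreover have "finite (branches \<Gamma> S i j)"
      by (rule finite_branches) (simp add: verts_graph finite_idx)
    ultimately have "(SOME q. q \<in> branches \<Gamma> S i j) = p"
      using p by (metis One_nat_def card_le_Suc0_iff_eq some_in_eq empty_iff)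
    then show ?thesis using p by (auto simp: \<tau>_def)
  qed
  have len: "1 \<le> vwalk_length p \<and> vwalk_length p \<le> dim N" if "p \<in> branches \<Gamma> S i j" for p i
  proof -
    have p: "1 \<le> vwalk_length p" "set p \<subseteq> idx N" "distinct (tl p)"
      using that by (auto simp: branches_def vcycle_def vpath_def vwalk_def verts_graph distinct_tl split: if_splits)
    then have "card (set (tl p)) \<le> card (idx N)"
      by (intro card_mono finite_idx) (cases p, auto)
    then show ?thesis using p by (simp add: distinct_card idx_def)
  qed
  show ?thesis
  proof (rule that[of \<tau>])
    show "1 \<le> \<tau> i \<and> \<tau> i \<le> dim N" for i
      using len[of "SOME p. p \<in> branches \<Gamma> S i j" i] dyn
      by (auto simp: \<tau>_def some_in_eq dynamical_network_def)
  next
    fix i assume i: "i \<in> nbrs N j \<inter> S"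
    then have "[i, j] \<in> branches \<Gamma> S i j"
      using j' in_idx[of i]
      by (auto simp: branches_def vcycle_def vpath_def vwalk_def verts_graph arcs_ends_graph interior_verts_def)
    then show "\<tau> i = 1" using unique i by auto
  next
    fix k l i assume l: "l \<in> subst_vars N S j k - S" and i: "i \<in> nbrs N l \<inter> S"
    obtain p where p: "vwalk p \<Gamma>" "hd p = l" "last p = j" "length p = k + 2" "distinct p"
      "set (butlast p) \<inter> S = {}"
      by (rule walk_to_subst_var[OF j l])
    have l': "l \<in> idx N" using l subst_vars_subset_idx[OF j'] by auto
    have p0: "p \<noteq> []" using p by auto
    then have "set p = insert j (set (butlast p))"
      using p(3) by (metis append_butlast_last_id list.set(2) rotate1.simps(2) set_rotate1)
    then have dist: "i \<notin> set p \<or> i = j" using i p(6) by auto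
    have "vwalk (i # p) \<Gamma>"
      using p i l' in_idx[of i] by (intro vwalk_consI) (auto simp: verts_graph arcs_ends_graph)
    then have "i # p \<in> branches \<Gamma> S i j"
      using p p0 dist by (auto simp: branches_def vcycle_def vpath_def interior_verts_def)
    then have "\<tau> i = vwalk_length (i # p)" using unique i by blast
    then show "\<tau> i = k + 2" using p by simp
  qed
qed

text \<open>
  The link between the two dynamics: along an orbit of the network, the coordinates in \<open>S\<close> satisfy
  the equation of the restriction, with each variable read at its own earlier time.  Constant
  orbits are included, so the fixed point satisfies the same equation.
\<close>

lemma orbit_is_delayed_restriction:
  assumes j: "j \<in> S"
  shows "\<exists>\<tau>. (\<forall>i. 1 \<le> \<tau> i \<and> \<tau> i \<le> dim N) \<and>
    (\<forall>X T. (\<forall>t. \<forall>i\<in>idx N. X (Suc t) i = component N i (X t)) \<longrightarrow> dim N \<le> T \<longrightarrow>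
       X T j = restr_component N S j (\<lambda>i\<in>S. X (T - \<tau> i) i))"
proof -
  note j' = in_idx[OF j]
  obtain \<tau> where \<tau>: "\<And>i. 1 \<le> \<tau> i \<and> \<tau> i \<le> dim N" "\<And>i. i \<in> nbrs N j \<inter> S \<Longrightarrow> \<tau> i = 1"
    "\<And>k l i. l \<in> subst_vars N S j k - S \<Longrightarrow> i \<in> nbrs N l \<inter> S \<Longrightarrow> \<tau> i = k + 2"
    by (rule branch_delays[OF j]) blast
  have "X T j = restr_component N S j (\<lambda>i\<in>S. X (T - \<tau> i) i)"
    if X: "\<forall>t. \<forall>i\<in>idx N. X (Suc t) i = component N i (X t)" and T: "dim N \<le> T" for X T
  proof -
    have step: "X t i = component N i (X (t - 1))" if "1 \<le> t" "i \<in> idx N" for t i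
      using bspec[OF spec[OF X, of "t - 1"] that(2)] that(1) by simp
    have "1 \<le> T" using \<tau>(1) T by (meson order_trans)
    \<comment> \<open>After \<open>k\<close> substitutions the variables outside \<open>S\<close> stand for values at time \<open>T - (k + 1)\<close>,
      while those in \<open>S\<close> were frozen when first reached, at time \<open>T - \<tau> i\<close>.\<close>
    have main: "subst_fun N S j k y = X T j"
      if "\<And>l. l \<in> subst_vars N S j k - S \<Longrightarrow> y l = X (T - (k + 1)) l"
        and "\<And>i. i \<in> subst_vars N S j k \<inter> S \<Longrightarrow> y i = X (T - \<tau> i) i" for k y
      using that
    proof (induction k arbitrary: y)
      case 0
      have "y l = X (T - 1) l" if "l \<in> nbrs N j" for l
        using that 0 \<tau>(2)[of l] by (cases "l \<in> S") auto
      then show ?case using step[OF \<open>1 \<le> T\<close> j'] by (auto intro: component_cong)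
    next
      case (Suc k)
      show ?case unfolding subst_fun.simps
      proof (rule Suc.IH)
        fix l assume l: "l \<in> subst_vars N S j k - S"
        then have l': "l \<in> idx N" using subst_vars_subset_idx[OF j'] by auto
        have kT: "k + 2 \<le> T" using subst_depth_bound[OF j l] T by simp
        have "y i = X (T - (k + 2)) i" if "i \<in> nbrs N l" for i
        proof (cases "i \<in> S")
          case True
          then have "i \<in> subst_vars N S j (Suc k) \<inter> S" using that l by auto
          then show ?thesis using Suc.prems(2)[of i] \<tau>(3)[OF l, of i] True that by simp
        next
          case False
          then have "i \<in> subst_vars N S j (Suc k) - S" using that l by auto
          then have "y i = X (T - (Suc k + 1)) i" by (rule Suc.prems(1))
          then show ?thesis by simp
        qed
        then have "component N l y = component N l (X (T - (k + 2)))"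
          by (rule component_cong)
        also have "\<dots> = X (T - (k + 1)) l"
          using step[of "T - (k + 1)" l] kT l' by (simp add: numeral_2_eq_2)
        finally show "(\<lambda>l\<in>subst_vars N S j k. if l \<in> S then y l else component N l y) l
            = X (T - (k + 1)) l" using l by simp
      next
        fix i assume i: "i \<in> subst_vars N S j k \<inter> S"
        then have "y i = X (T - \<tau> i) i" by (intro Suc.prems) auto
        then show "(\<lambda>l\<in>subst_vars N S j k. if l \<in> S then y l else component N l y) i
            = X (T - \<tau> i) i" using i by simp
      qed
    qed
    show ?thesis
      unfolding restr_component_def
      by (rule main[symmetric]) (use restr_vars_subset_S[OF j] in \<open>auto simp: restr_vars_def\<close>)
  qed
  then show ?thesis using \<tau>(1) by (intro exI[of _ \<tau>] conjI allI impI) blast+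
qed

section \<open>Transfer of attracting fixed points\<close>

lemma restriction_map_prod_space:
  assumes "x \<in> prod_space N S"
  shows "restriction_map N S x \<in> prod_space N S"
  unfolding prod_space_def
proof (rule PiE_I)
  fix j assume j: "j \<in> S"
  have "restr_component N S j x \<in> carr N j"
    unfolding restr_component_def
  proof (rule subst_fun_in_carr[OF in_idx[OF j]])
    fix i assume "i \<in> subst_vars N S j (subst_depth N S j)"
    then have "i \<in> S" using restr_vars_subset_S[OF j] by (auto simp: restr_vars_def)
    then show "x i \<in> carr N i" using assms by (auto simp: prod_space_def)
  qed
  then show "restriction_map N S x j \<in> carr N j" using j by (simp add: restriction_map_def)
qed (simp add: restriction_map_def)

lemma S_spaces:
  assumes "i \<in> S"
  shows "carr N i \<noteq> {} \<and> Metric_space (carr N i) (metr N i) \<and>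
    Metric_space.mcomplete (carr N i) (metr N i)"
  using component_space[OF in_idx[OF assms]] by blast

lemma finite_S: "finite S"
  using S_subset_idx finite_idx by (rule finite_subset)

text \<open>
  The stability matrix has the entry \<open>\<Lambda> i j * L_i\<close> in row \<open>j\<close> and column \<open>i\<close>, so its weights make every
  component a weighted contraction, and with them the restricted components.
\<close>

lemma stability_matrix_imp_restriction_attracts:
  assumes A: "stability_matrix N A" "spec_rad A < 1"
  shows "\<exists>z. globally_attracting_fixed_point N S (restriction_map N S) z"
proof -
  obtain \<Lambda> where L: "lip_bounds N \<Lambda>"
    and A_eq: "A = transpose_mat (indexed_mat (idx N) \<Lambda>) *
            mat_diag (dim N) (\<lambda>a. lip_const N (enum_idx (idx N) a))"
    using A by (auto simp: stability_matrix_def)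
  have card: "card (idx N) = dim N" by (simp add: idx_def)
  have "A = indexed_mat (idx N) (\<lambda>j i. \<Lambda> i j * lip_const N i)"
    unfolding A_eq by (subst mat_diag_mult_right[of _ "dim N" "dim N"]) (auto simp: indexed_mat_def card)
  then have sr: "spec_rad (indexed_mat (idx N) (\<lambda>j i. \<Lambda> i j * lip_const N i)) < 1"
    using A by simp
  have ne: "idx N \<noteq> {}" using S_nonempty S_subset_idx by auto
  have nonneg: "0 \<le> \<Lambda> i j * lip_const N i" if "i \<in> idx N" "j \<in> idx N" for i j
    using L that lip_const_nonneg by (auto simp: lip_bounds_def)
  obtain w c where w: "\<And>j. j \<in> idx N \<Longrightarrow> 0 < w j" and c: "0 \<le> c" "c < 1"
    and Mw: "\<And>j. j \<in> idx N \<Longrightarrow> (\<Sum>i\<in>idx N. \<Lambda> i j * lip_const N i * w i) \<le> c * w j"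
    using indexed_mat_weights[OF finite_idx ne nonneg sr] by blast
  show ?thesis
  proof (rule weighted_contraction_attracts[OF finite_S S_nonempty S_spaces
        restriction_map_prod_space w c])
    show "i \<in> idx N" if "i \<in> S" for i using that by (rule in_idx)
    fix x y t j
    assume x: "x \<in> prod_space N S" and y: "y \<in> prod_space N S" and t: "(0::real) \<le> t"
      and b: "\<And>i. i \<in> S \<Longrightarrow> metr N i (x i) (y i) \<le> t * w i" and j: "j \<in> S"
    have vars: "i \<in> S" if "i \<in> subst_vars N S j (subst_depth N S j)" for i
      using that restr_vars_subset_S[OF j] by (auto simp: restr_vars_def)
    have "metr N j (restr_component N S j x) (restr_component N S j y) \<le> c * t * w j"
      unfolding restr_component_def
      by (rule subst_fun_contraction[OF L w _ t Mw in_idx[OF j]])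
         (use vars x y b c in \<open>auto simp: prod_space_def\<close>)
    then show "metr N j (restriction_map N S x j) (restriction_map N S y j) \<le> c * t * w j"
      using j by (simp add: restriction_map_def)
  qed
qed

text \<open>
  A fixed point of the restriction fixes the coordinates in \<open>S\<close>; the other coordinates are then
  determined one rank at a time by their own components, since those only look at \<open>S\<close> and at lower
  ranks.
\<close>

lemma fixed_point_lift:
  assumes z: "z \<in> prod_space N S" "restriction_map N S z = z"
  obtains z' where "z' \<in> prod_space N (idx N)" "network_map N z' = z'" "restrict z' S = z"
proof -
  obtain h where h: "\<And>i l. l \<in> idx N - S \<Longrightarrow> i \<in> nbrs N l - S \<Longrightarrow> h i < (h l :: nat)"
    by (rule rank_outside_S) blast
  have "\<exists>u\<in>prod_space N (idx N). (\<forall>i\<in>S. u i = z i) \<and>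
      (\<forall>l\<in>idx N - S. h l < m \<longrightarrow> component N l u = u l)" for m
  proof (induction m)
    case 0
    let ?u = "\<lambda>i\<in>idx N. if i \<in> S then z i else SOME a. a \<in> carr N i"
    have "?u \<in> prod_space N (idx N)"
      using z(1) component_space(1) by (auto simp: prod_space_def some_in_eq)
    then show ?case using in_idx by (intro bexI[of _ ?u]) auto
  next
    case (Suc m)
    then obtain u where u: "u \<in> prod_space N (idx N)" "\<And>i. i \<in> S \<Longrightarrow> u i = z i"
      "\<And>l. l \<in> idx N - S \<Longrightarrow> h l < m \<Longrightarrow> component N l u = u l" by blast
    let ?u = "\<lambda>l\<in>idx N. if l \<in> S \<or> h l \<noteq> m then u l else component N l u"
    have uC: "u i \<in> carr N i" if "i \<in> idx N" for i using u(1) that by (auto simp: prod_space_def)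
    have "component N l u \<in> carr N l" if "l \<in> idx N" for l
      using uC nbrs_subset_idx[OF that] by (intro component_in_carr[OF that]) auto
    then have "?u \<in> prod_space N (idx N)"
      using uC by (auto simp: prod_space_def)
    moreover have "component N l ?u = ?u l" if l: "l \<in> idx N - S" "h l < Suc m" for l
    proof -
      have "component N l ?u = component N l u"
      proof (rule component_cong)
        fix i assume i: "i \<in> nbrs N l"
        then have "i \<in> idx N" using nbrs_subset_idx l by auto
        moreover have "i \<in> S \<or> h i \<noteq> m" using h[OF l(1), of i] i l(2) by auto
        ultimately show "?u i = u i" by simp
      qed
      also have "\<dots> = ?u l" using u(3)[OF l(1)] l by auto
      finally show ?thesis .
    qed
    moreover have "?u i = z i" if "i \<in> S" for i
      using u(2) in_idx that by simp
    ultimately show ?case by blast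
  qed
  from this[of "Suc (Max (h ` idx N))"] obtain u where u: "u \<in> prod_space N (idx N)"
    "\<And>i. i \<in> S \<Longrightarrow> u i = z i" "\<And>l. l \<in> idx N - S \<Longrightarrow> component N l u = u l"
    using finite_idx by (auto simp: less_Suc_eq_le)
  have S: "component N j u = u j" if j: "j \<in> S" for j
  proof -
    have "component N j u = subst_fun N S j (subst_depth N S j) u"
      by (rule subst_fun_fixed[OF in_idx[OF j] u(3), symmetric])
    also have "\<dots> = restr_component N S j z"
      unfolding restr_component_def
      using restr_vars_subset_S[OF j] u(2)
      by (intro subst_fun_cong) (auto simp: restr_vars_def)
    also have "\<dots> = restriction_map N S z j" using j by (simp add: restriction_map_def)
    finally show ?thesis using z(2) u(2) j by simp
  qed
  show ?thesis
  proof (rule that[OF u(1)])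
    show "network_map N u = u"
      using network_map_prod_space[OF u(1)] u(1) unfolding prod_space_def
    proof (rule PiE_ext)
      fix i assume i: "i \<in> idx N"
      show "network_map N u i = u i"
        unfolding network_map_apply[OF i] using S u(3) i by blast
    qed
    show "restrict u S = z"
      using u(2) z(1) by (auto simp: prod_space_def PiE_def extensional_def restrict_def fun_eq_iff)
  qed
qed

text \<open>
  The restriction has a fixed point by contraction, and it lifts to the network.  Distances to it
  decay on \<open>S\<close> by the delayed contraction, and from there convergence spreads through the ranks,
  where the Lipschitz constants may be arbitrarily large: they enter only finitely often.
\<close>

lemma restr_stability_matrix_imp_network_attracts:
  assumes A: "restr_stability_matrix N S A" "spec_rad A < 1"
  shows "\<exists>z. globally_attracting_fixed_point N (idx N) (network_map N) z"
proof -
  obtain \<Lambda> where L: "\<And>i j. i \<in> S \<Longrightarrow> j \<in> S \<Longrightarrow> 0 \<le> \<Lambda> i j"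
    and lip: "\<And>j x y. j \<in> S \<Longrightarrow> x \<in> prod_space N S \<Longrightarrow> y \<in> prod_space N S \<Longrightarrow>
           metr N j (restr_component N S j x) (restr_component N S j y)
             \<le> (\<Sum>i\<in>S. \<Lambda> i j * metr N i (x i) (y i))"
    and A_eq: "A = transpose_mat (indexed_mat S \<Lambda>)"
    using A unfolding restr_stability_matrix_def by blast
  have "A = indexed_mat S (\<lambda>j i. \<Lambda> i j)"
    unfolding A_eq by (auto simp: indexed_mat_def)
  then have sr: "spec_rad (indexed_mat S (\<lambda>j i. \<Lambda> i j)) < 1" using A by simp
  note ms = component_space(2)
  obtain w c where w: "\<And>j. j \<in> S \<Longrightarrow> 0 < w j" and c: "0 \<le> c" "c < 1"
    and Mw: "\<And>j. j \<in> S \<Longrightarrow> (\<Sum>i\<in>S. \<Lambda> i j * w i) \<le> c * w j"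
    using indexed_mat_weights[OF finite_S S_nonempty L sr] by blast
  have "\<exists>z. globally_attracting_fixed_point N S (restriction_map N S) z"
  proof (rule weighted_contraction_attracts[OF finite_S S_nonempty S_spaces restriction_map_prod_space w c])
    fix x y t j
    assume x: "x \<in> prod_space N S" and y: "y \<in> prod_space N S" and t: "(0::real) \<le> t"
      and b: "\<And>i. i \<in> S \<Longrightarrow> metr N i (x i) (y i) \<le> t * w i" and j: "j \<in> S"
    have "metr N j (restr_component N S j x) (restr_component N S j y)
        \<le> (\<Sum>i\<in>S. \<Lambda> i j * metr N i (x i) (y i))" by (rule lip[OF j x y])
    also have "\<dots> \<le> (\<Sum>i\<in>S. \<Lambda> i j * (t * w i))"
      using b L j by (intro sum_mono mult_left_mono) auto
    also have "\<dots> = t * (\<Sum>i\<in>S. \<Lambda> i j * w i)" by (simp add: sum_distrib_left mult_ac)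
    also have "\<dots> \<le> t * (c * w j)" using Mw[OF j] t by (rule mult_left_mono)
    finally show "metr N j (restriction_map N S x j) (restriction_map N S y j) \<le> c * t * w j"
      using j by (simp add: restriction_map_def mult_ac)
  qed
  then obtain zS where "zS \<in> prod_space N S" "restriction_map N S zS = zS"
    by (auto simp: globally_attracting_fixed_point_def)
  then obtain z where z: "z \<in> prod_space N (idx N)" "network_map N z = z"
    by (rule fixed_point_lift)
  have z_step: "z i = component N i z" if "i \<in> idx N" for i
    using network_map_apply[OF that, of z] z(2) by simp
  obtain \<Lambda>' where L': "lip_bounds N \<Lambda>'" using dyn by (auto simp: dynamical_network_def)
  obtain h where h: "\<And>i l. l \<in> idx N - S \<Longrightarrow> i \<in> nbrs N l - S \<Longrightarrow> h i < (h l :: nat)"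
    by (rule rank_outside_S) blast
  let ?delays = "\<lambda>j \<tau>. (\<forall>i. 1 \<le> \<tau> i \<and> \<tau> i \<le> dim N) \<and>
      (\<forall>X T. (\<forall>t. \<forall>i\<in>idx N. X (Suc t) i = component N i (X t)) \<longrightarrow> dim N \<le> T \<longrightarrow>
         X T j = restr_component N S j (\<lambda>i\<in>S. X (T - \<tau> i) i))"
  have "\<forall>j\<in>S. \<exists>\<tau>. ?delays j \<tau>"
    using orbit_is_delayed_restriction by (rule ballI)
  from bchoice[OF this] obtain \<tau> where delays: "\<forall>j\<in>S. ?delays j (\<tau> j)" ..
  have \<tau>: "1 \<le> \<tau> j i \<and> \<tau> j i \<le> dim N" if "j \<in> S" for i j
    using delays that by blast
  have delay: "X T j = restr_component N S j (\<lambda>i\<in>S. X (T - \<tau> j i) i)"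
    if "j \<in> S" "\<forall>t. \<forall>i\<in>idx N. X (Suc t) i = component N i (X t)" "dim N \<le> T" for X T j
    using bspec[OF delays that(1)] that(2,3) by blast
  have "(\<lambda>k. dmax N (idx N) ((network_map N ^^ k) y) z) \<longlonglongrightarrow> 0" if y: "y \<in> prod_space N (idx N)" for y
  proof -
    define X where "X t = (network_map N ^^ t) y" for t
    define e where "e t i = metr N i (X t i) (z i)" for t i
    have X: "X t \<in> prod_space N (idx N)" for t
      unfolding X_def using y network_map_prod_space by (induction t) auto
    have in_carr: "X t i \<in> carr N i" "z i \<in> carr N i" if "i \<in> idx N" for t i
      using X[of t] z(1) that by (auto simp: prod_space_def)
    have X_step: "X (Suc t) i = component N i (X t)" if "i \<in> idx N" for t i
      using network_map_apply[OF that] by (simp add: X_def)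
    have e0: "0 \<le> e t i" if "i \<in> idx N" for t i
      unfolding e_def using Metric_space.nonneg[OF ms[OF that]] .
    have S_lim: "(\<lambda>t. e t j) \<longlonglongrightarrow> 0" if "j \<in> S" for j
    proof (rule delayed_contraction_tendsto_0[OF finite_S w c _ Mw \<tau> _ _ that])
      show "0 \<le> e t j" if "j \<in> S" for t j using e0 in_idx that by blast
      fix t j assume j: "j \<in> S" and t: "dim N \<le> t"
      have "e t j = metr N j (restr_component N S j (\<lambda>i\<in>S. X (t - \<tau> j i) i))
                             (restr_component N S j (\<lambda>i\<in>S. z i))"
        unfolding e_def using delay[OF j _ t, of X] delay[OF j _ t, of "\<lambda>_. z"] X_step z_step by simp
      also have "\<dots> \<le> (\<Sum>i\<in>S. \<Lambda> i j * metr N i ((\<lambda>i\<in>S. X (t - \<tau> j i) i) i) ((\<lambda>i\<in>S. z i) i))"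
        using in_carr in_idx by (intro lip j) (auto simp: prod_space_def)
      finally show "e t j \<le> (\<Sum>i\<in>S. \<Lambda> i j * e (t - \<tau> j i) i)"
        by (simp add: e_def)
    qed (use L in auto)
    have lim: "(\<lambda>t. e t l) \<longlonglongrightarrow> 0" if "l \<in> idx N" for l
      using that
    proof (induction "h l" arbitrary: l rule: less_induct)
      case less
      show ?case
      proof (cases "l \<in> S")
        case True
        then show ?thesis by (rule S_lim)
      next
        case False
        have nb: "i \<in> idx N" if "i \<in> nbrs N l" for i
          using nbrs_subset_idx[OF less.prems] that by auto
        have lim_i: "(\<lambda>t. e t i) \<longlonglongrightarrow> 0" if "i \<in> nbrs N l" for i
          using less.hyps[of i] h[of l i] S_lim nb that False less.prems by blast
        have "(\<lambda>t. e (Suc t) l) \<longlonglongrightarrow> 0"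
        proof (rule tendsto_sandwich[OF _ _ tendsto_const])
          show "\<forall>\<^sub>F t in sequentially. 0 \<le> e (Suc t) l" using e0[OF less.prems] by simp
          have "e (Suc t) l \<le> (\<Sum>i\<in>nbrs N l. \<Lambda>' i l * lip_const N i * e t i)" for t
            unfolding e_def X_step[OF less.prems] using z_step[OF less.prems] in_carr nb
              component_lipschitz[OF L' less.prems, of "X t" z] by simp
          then show "\<forall>\<^sub>F t in sequentially. e (Suc t) l \<le> (\<Sum>i\<in>nbrs N l. \<Lambda>' i l * lip_const N i * e t i)"
            by simp
          show "(\<lambda>t. \<Sum>i\<in>nbrs N l. \<Lambda>' i l * lip_const N i * e t i) \<longlonglongrightarrow> 0"
            by (intro tendsto_null_sum tendsto_mult_right_zero lim_i)
        qed
        then show ?thesis by (rule LIMSEQ_imp_Suc)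
      qed
    qed
    show ?thesis
      using lim unfolding e_def X_def
      by (intro dmax_tendsto_0 finite_idx ms) (use S_nonempty in_idx in auto)
  qed
  then show ?thesis unfolding globally_attracting_fixed_point_def using z by blast
qed

end

theorem theorem6p4:
  fixes N :: "'a network" and S :: "nat set"
  assumes "dynamical_network N"
    and "basic_structural_set (interaction_graph N) S"
  shows "(\<forall>A. stability_matrix N A \<and> spec_rad A < 1 \<longrightarrow>
            (\<exists>z. globally_attracting_fixed_point N S (restriction_map N S) z)) \<and>
         (\<forall>A'. restr_stability_matrix N S A' \<and> spec_rad A' < 1 \<longrightarrow>
            (\<exists>z. globally_attracting_fixed_point N (idx N) (network_map N) z))"
proof -
  interpret basic_structural_setting N S
    using assms by unfold_locales
  show ?thesis
    using stability_matrix_imp_restriction_attracts restr_stability_matrix_imp_network_attracts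
    by blast
qed

end
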